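(* Let $\lambda\in\mathbb{R}$, $\alpha,\beta\in2\mathbb{Z}_{>0}$ and $\rho,\sigma\in\mathbb{R}_{\ge3}$, and let $$(a,b,c,d)=(1+\rho+\sigma,\;1-\rho+\sigma,\;1+\alpha+\rho-\beta-\sigma,\;1-\alpha-\rho-\beta-\sigma).$$ Let $\Delta$ be the $\tau^{-1}$-periodic meromorphic function $$\Delta(x)=\frac{\Gamma_{2\tau}\bigl(-1+\frac1{2\tau}+a-x\bigr)\,\Gamma_{2\tau}\bigl(-1+\frac1{2\tau}+b-x\bigr)}{\Gamma_{2\tau}\bigl(1+\frac1{2\tau}-c-x\bigr)\,\Gamma_{2\tau}\bigl(1+\frac1{2\tau}-d-x\bigr)},$$ and define $F_\lambda(x)=\Delta(x)^{-1}\phi_\lambda(x)$. Then $F_\lambda$ satisfies the Askey-Wilson second order difference equation $$A(x)\bigl(F_\lambda(x+2)-F_\lambda(x)\bigr)+A(-x)\bigl(F_\lambda(x-2)-F_\lambda(x)\bigr)=E(\lambda)F_\lambda(x)$$ for generic $x\in i\mathbb{R}$ and generic $\rho$ and $\sigma$, where $$A(x)=\frac{(1-q^{a+x})(1-q^{b+x})(1-q^{c+x})(1-q^{d+x})}{(1-q^{2x})(1-q^{2+2x})},\qquad E(\lambda)=-1-q^{2-2\beta}+q^{1-\beta}(q^{2i\lambda}+q^{-2i\lambda}).$$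
   Context: Here $\tau\in i\mathbb{R}_{>0}$, $q=\exp(2\pi i\tau)\in(0,1)$, $q^u=\exp(2\pi i\tau u)$ for $u\in\mathbb{C}$, and $(b;q^2)_\infty=\prod_{j\ge0}(1-bq^{2j})$. Define the meromorphic function $\Gamma_{2\tau}(x)=\dfrac{q^{-x^2/8}}{(-q^{x+1};q^2)_\infty}$, and $$f_\lambda(z;\alpha,\rho)=\frac{\Gamma_{2\tau}\bigl(-1-\frac1{2\tau}+\alpha+\rho-i\lambda+z\bigr)\,\Gamma_{2\tau}\bigl(-\frac1{2\tau}+\rho-i\lambda-z\bigr)}{\Gamma_{2\tau}\bigl(1-\frac1{2\tau}+\alpha+\rho+i\lambda-z\bigr)\,\Gamma_{2\tau}\bigl(-\frac1{2\tau}+\rho+i\lambda+z\bigr)}.$$ For $x\in\mathbb{C}$ with $|\mathrm{Re}(x)|\le2$, $$\phi_\lambda(x)=\int_0^1f_\lambda\bigl(1+x+\tfrac{y}{\tau};\beta,\sigma\bigr)\,\overline{f_\lambda\bigl(\tfrac{y}{\tau};\alpha,\rho\bigr)}\,dy .$$ *)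

theory Defs
  imports "HOL-Complex_Analysis.Complex_Analysis"
begin

text \<open>
  Throughout, \<open>\<tau>\<close> is a point of the positive imaginary axis, so that \<open>q = exp (2\<pi>i\<tau>)\<close> lies in
  \<open>(0,1)\<close>. All powers of \<open>q\<close> are taken with respect to this fixed logarithm; in particular
  \<open>q^(1/(2\<tau>)) = -1\<close>.
\<close>

definition qpow :: "complex \<Rightarrow> complex \<Rightarrow> complex"
  where "qpow \<tau> u = exp (2 * of_real pi * \<i> * \<tau> * u)"

definition qpochhammer_inf :: "complex \<Rightarrow> complex \<Rightarrow> complex"
  where "qpochhammer_inf b p = (\<Prod>j. 1 - b * p ^ j)"

text \<open>
  The poles of \<open>Gamma2tau \<tau>\<close> are the zeros of its denominator, and its value there is \<open>0\<close> by
  the convention \<open>x / 0 = 0\<close>. It has no zeros, so its reciprocal takes the correct value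
  everywhere.
\<close>

definition Gamma2tau :: "complex \<Rightarrow> complex \<Rightarrow> complex"
  where "Gamma2tau \<tau> x = qpow \<tau> (- (x\<^sup>2 / 8)) / qpochhammer_inf (- qpow \<tau> (x + 1)) (qpow \<tau> 2)"

definition f_AW :: "complex \<Rightarrow> real \<Rightarrow> complex \<Rightarrow> real \<Rightarrow> real \<Rightarrow> complex"
  where "f_AW \<tau> lam z \<alpha> \<rho> =
    (Gamma2tau \<tau> (- 1 - 1 / (2 * \<tau>) + of_real \<alpha> + of_real \<rho> - \<i> * of_real lam + z) *
     Gamma2tau \<tau> (- (1 / (2 * \<tau>)) + of_real \<rho> - \<i> * of_real lam - z)) /
    (Gamma2tau \<tau> (1 - 1 / (2 * \<tau>) + of_real \<alpha> + of_real \<rho> + \<i> * of_real lam - z) *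
     Gamma2tau \<tau> (- (1 / (2 * \<tau>)) + of_real \<rho> + \<i> * of_real lam + z))"

text \<open>
  For \<open>\<alpha>, \<beta> > 0\<close> and \<open>\<rho>, \<sigma> \<ge> 3\<close> the following function is meaningful for \<open>\<bar>Re x\<bar> \<le> 2\<close>: the
  integrand then has no poles on \<open>[0,1]\<close> and is continuous in \<open>y\<close>. It is only used there.
\<close>

definition phi_AW :: "complex \<Rightarrow> real \<Rightarrow> real \<Rightarrow> real \<Rightarrow> real \<Rightarrow> real \<Rightarrow> complex \<Rightarrow> complex"
  where "phi_AW \<tau> \<alpha> \<beta> \<rho> \<sigma> lam x =
    integral {0..1} (\<lambda>y::real.
      f_AW \<tau> lam (1 + x + of_real y / \<tau>) \<beta> \<sigma> * cnj (f_AW \<tau> lam (of_real y / \<tau>) \<alpha> \<rho>))"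

definition Delta_AW :: "complex \<Rightarrow> real \<Rightarrow> real \<Rightarrow> real \<Rightarrow> real \<Rightarrow> complex \<Rightarrow> complex"
  where "Delta_AW \<tau> a b c d x =
    (Gamma2tau \<tau> (- 1 + 1 / (2 * \<tau>) + of_real a - x) *
     Gamma2tau \<tau> (- 1 + 1 / (2 * \<tau>) + of_real b - x)) /
    (Gamma2tau \<tau> (1 + 1 / (2 * \<tau>) - of_real c - x) *
     Gamma2tau \<tau> (1 + 1 / (2 * \<tau>) - of_real d - x))"

definition A_AW :: "complex \<Rightarrow> real \<Rightarrow> real \<Rightarrow> real \<Rightarrow> real \<Rightarrow> complex \<Rightarrow> complex"
  where "A_AW \<tau> a b c d x =
    ((1 - qpow \<tau> (of_real a + x)) * (1 - qpow \<tau> (of_real b + x)) *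
     (1 - qpow \<tau> (of_real c + x)) * (1 - qpow \<tau> (of_real d + x))) /
    ((1 - qpow \<tau> (2 * x)) * (1 - qpow \<tau> (2 + 2 * x)))"

definition E_AW :: "complex \<Rightarrow> real \<Rightarrow> real \<Rightarrow> complex"
  where "E_AW \<tau> \<beta> lam =
    - 1 - qpow \<tau> (2 - 2 * of_real \<beta>) +
    qpow \<tau> (1 - of_real \<beta>) *
      (qpow \<tau> (2 * \<i> * of_real lam) + qpow \<tau> (- (2 * \<i> * of_real lam)))"

text \<open>
  Genericity means avoiding poles. For \<open>\<alpha>, \<beta>\<close> positive and even, \<open>\<rho>, \<sigma> \<ge> 3\<close> and
  \<open>(a,b,c,d) = (1 + \<rho> + \<sigma>, 1 - \<rho> + \<sigma>, 1 + \<alpha> + \<rho> - \<beta> - \<sigma>, 1 - \<alpha> - \<rho> - \<beta> - \<sigma>)\<close>, the zeros and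
  poles of \<open>Delta_AW\<close> have real parts \<open>a + 2j\<close>, \<open>b + 2j\<close>, \<open>2 - c + 2j\<close>, \<open>2 - d + 2j\<close> with
  \<open>j \<ge> 0\<close>. Such a real part can be \<open>-2\<close>, \<open>0\<close> or \<open>2\<close> only if \<open>\<rho> - \<sigma>\<close> is an odd integer.
\<close>

definition generic_params :: "real \<Rightarrow> real \<Rightarrow> bool"
  where "generic_params \<rho> \<sigma> \<longleftrightarrow> (\<forall>k::int. \<rho> - \<sigma> \<noteq> 2 * of_int k + 1)"

text \<open>
  On the imaginary axis, \<open>A_AW\<close> at \<open>x\<close> and at \<open>-x\<close> has a vanishing denominator exactly if
  \<open>q^(2x) = 1\<close>, that is, for \<open>x\<close> in the discrete set \<open>(1/(2\<tau>))\<int>\<close>.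
\<close>

definition generic_point :: "complex \<Rightarrow> complex \<Rightarrow> bool"
  where "generic_point \<tau> x \<longleftrightarrow> qpow \<tau> (2 * x) \<noteq> 1"

end

theory Submission
  imports Defs
begin

text \<open>
  The functional equation of \<open>Gamma2tau\<close> turns \<open>f_AW\<close> into a solution of the first order difference
  equation \<open>(C \<rho> - C (z + 1 + i\<lambda>)) f(z + 2) = (C (\<alpha> + \<rho>) - C (z - i\<lambda>)) f(z)\<close>, where
  \<open>C u = q^u + q^(-u)\<close>, and the conjugate factor in \<open>phi_AW\<close> into a solution of a similar one.
  Shifting \<open>x\<close> by \<open>2\<close> in \<open>phi_AW\<close> shifts only the first factor of the integrand, so the integrands at
  \<open>x + 2\<close>, \<open>x\<close> and \<open>x - 2\<close> are rational multiples of each other, and a suitable linear combination of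
  them has the form \<open>h(z + 2) - h(z)\<close> with \<open>z = y/\<tau>\<close> (creative telescoping). Here \<open>h\<close> is
  \<open>1/\<tau>\<close>-periodic and holomorphic on a strip containing \<open>0 \<le> Re z \<le> 2\<close>, so the integrals of both terms
  over a period agree. This three term relation for \<open>phi_AW\<close>, divided by \<open>Delta_AW\<close>, is the Askey-Wilson
  equation.
\<close>

section \<open>Infinite q-shifted factorials\<close>

text \<open>On the ball of radius R the factors differ from 1 by at most R |p|^j, a summable
  majorant independent of b. The uniform version is what yields holomorphy in b.\<close>

lemma
  fixes p :: complex
  assumes "norm p < 1"
  shows convergent_prod_qpochhammer: "convergent_prod (\<lambda>j. 1 - b * p ^ j)"
    and uniform_limit_qpochhammer_inf: "R > 0 \<Longrightarrow>
      uniform_limit (cball 0 R) (\<lambda>N b. \<Prod>j<N. 1 - b * p ^ j) (\<lambda>b. qpochhammer_inf b p) sequentially"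
proof -
  have conv: "convergent_prod (\<lambda>j. 1 - b * p ^ j)" for b
  proof (rule abs_convergent_prod_imp_convergent_prod, rule summable_imp_abs_convergent_prod)
    have "summable (\<lambda>j. norm b * norm p ^ j)"
      using assms by (intro summable_mult summable_geometric) auto
    then show "summable (\<lambda>j. norm (1 - b * p ^ j - 1))"
      by (simp add: norm_mult norm_power)
  qed
  then show "convergent_prod (\<lambda>j. 1 - b * p ^ j)" .
  assume "R > 0"
  have "uniformly_convergent_on (cball 0 R) (\<lambda>N b. \<Prod>j<N. 1 - b * p ^ j)"
  proof (rule uniformly_convergent_on_prod')
    show "uniformly_convergent_on (cball 0 R) (\<lambda>N b. \<Sum>j<N. norm (1 - b * p ^ j - 1))"
    proof (rule Weierstrass_m_test')
      show "summable (\<lambda>j. R * norm p ^ j)"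
        using assms by (intro summable_mult summable_geometric) auto
    qed (auto simp: norm_mult norm_power intro!: mult_right_mono)
  qed (auto intro!: continuous_intros)
  from this[unfolded uniformly_convergent_on_def]
  obtain g where g: "uniform_limit (cball 0 R) (\<lambda>N b. \<Prod>j<N. 1 - b * p ^ j) g sequentially" ..
  have eq: "g b = qpochhammer_inf b p" if "b \<in> cball 0 R" for b
  proof -
    have "(\<lambda>N. \<Prod>j<N. 1 - b * p ^ j) \<longlonglongrightarrow> g b"
      by (rule tendsto_uniform_limitI[OF g that])
    \<comment> \<open>\<open>convergent_prod_LIMSEQ\<close> speaks of products over j <= N, hence
      the shift by one.\<close>
    then have "(\<lambda>N. \<Prod>j<Suc N. 1 - b * p ^ j) \<longlonglongrightarrow> g b"
      by (rule LIMSEQ_Suc)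
    moreover have "(\<lambda>N. \<Prod>j<Suc N. 1 - b * p ^ j) \<longlonglongrightarrow> qpochhammer_inf b p"
      using convergent_prod_LIMSEQ[OF conv[of b]] unfolding lessThan_Suc_atMost
      by (simp add: qpochhammer_inf_def)
    ultimately show ?thesis
      by (rule LIMSEQ_unique)
  qed
  show "uniform_limit (cball 0 R) (\<lambda>N b. \<Prod>j<N. 1 - b * p ^ j) (\<lambda>b. qpochhammer_inf b p) sequentially"
    by (rule uniform_limit_cong[THEN iffD1, OF _ _ g]) (simp_all add: eq)
qed

lemma holomorphic_on_qpochhammer_inf:
  assumes "norm p < 1" "f holomorphic_on A"
  shows "(\<lambda>z. qpochhammer_inf (f z) p) holomorphic_on A"
proof -
  have "(\<lambda>b. qpochhammer_inf b p) holomorphic_on UNIV"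
  proof (rule holomorphic_uniform_sequence)
    fix b :: complex
    have "uniform_limit (cball 0 (norm b + 1)) (\<lambda>N b. \<Prod>j<N. 1 - b * p ^ j)
        (\<lambda>b. qpochhammer_inf b p) sequentially"
      by (rule uniform_limit_qpochhammer_inf) (use assms in \<open>auto intro: add_nonneg_pos\<close>)
    then have "uniform_limit (cball b 1) (\<lambda>N b. \<Prod>j<N. 1 - b * p ^ j) (\<lambda>b. qpochhammer_inf b p) sequentially"
      by (rule uniform_limit_on_subset) (simp add: cball_subset_cball_iff)
    then show "\<exists>d>0. cball b d \<subseteq> UNIV \<and>
        uniform_limit (cball b d) (\<lambda>N b. \<Prod>j<N. 1 - b * p ^ j) (\<lambda>b. qpochhammer_inf b p) sequentially"
      by (intro exI[of _ 1]) auto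
  qed (auto intro!: holomorphic_intros)
  from holomorphic_on_compose_gen[OF assms(2) this] show ?thesis
    by (simp add: o_def)
qed

lemma qpochhammer_inf_eq_0_iff:
  assumes "norm p < 1"
  shows "qpochhammer_inf b p = 0 \<longleftrightarrow> (\<exists>j. b * p ^ j = 1)"
  using has_prod_eq_0_iff[OF convergent_prod_has_prod[OF convergent_prod_qpochhammer[OF assms, of b]]]
  unfolding qpochhammer_inf_def by (auto simp: image_iff)

text \<open>The first factor is split off. If some factor vanishes, both sides are 0 by the zero
  criterion; otherwise the head can be divided out.\<close>

lemma qpochhammer_inf_rec:
  assumes "norm p < 1"
  shows "qpochhammer_inf b p = (1 - b) * qpochhammer_inf (b * p) p"
proof (cases "b = 1")
  case True
  then show ?thesis
    using qpochhammer_inf_eq_0_iff[OF assms, of b] by (auto intro: exI[of _ 0])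
next
  case False
  then show ?thesis
  proof (cases "\<exists>j. b * p ^ j = 1")
    case True
    then obtain j where j: "b * p ^ j = 1" by blast
    with False obtain i where "j = Suc i" by (cases j) auto
    with j have "b * p * p ^ i = 1" by (simp add: mult_ac)
    then have "qpochhammer_inf (b * p) p = 0"
      using qpochhammer_inf_eq_0_iff[OF assms, of "b * p"] by blast
    moreover have "qpochhammer_inf b p = 0"
      using qpochhammer_inf_eq_0_iff[OF assms, of b] True by blast
    ultimately show ?thesis by simp
  next
    case nz: False
    have "1 - b * p ^ j \<noteq> 0" for j
      using nz by (metis eq_iff_diff_eq_0)
    then show ?thesis
      using prodinf_split_head[OF convergent_prod_qpochhammer[OF assms, of b]] False
      unfolding qpochhammer_inf_def by (simp add: mult_ac)
  qed
qed

section \<open>Rational identities\<close>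

text \<open>This is \<open>C\<close> in the multiplicative variable y = q^u, in which the difference
  equations become rational identities.\<close>

definition csum :: "complex \<Rightarrow> complex" where "csum y = y + 1 / y"

text \<open>
  After division by \<open>(u - csum (q\<^sup>2 X Y)) (V - csum (X Y / (q J)))\<close> this is an identity of rational
  functions of \<open>Y\<close>. The Laurent polynomial \<open>R\<close> and the coefficients on the left were found by comparing
  residues at the four poles; the terms of \<open>R\<close> in \<open>Y\<close> and \<open>1/Y\<close> do not spoil boundedness at
  \<open>Y = \<infinity>\<close> and \<open>Y = 0\<close>, as their contributions cancel there.
\<close>
lemma telescoping_identity:
  fixes u v U V X Y J q :: complex and R :: "complex \<Rightarrow> complex"
  assumes nz: "X \<noteq> 0" "Y \<noteq> 0" "J \<noteq> 0" "q \<noteq> 0"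
  assumes \<omega>: "\<omega> = X / q - q / X" and \<theta>: "\<theta> = q * X - 1 / (q * X)"
    and \<delta>: "\<delta> = \<theta> * U - V * (q\<^sup>2 - 1 / q\<^sup>2)"
    and R: "\<And>y. R y = X * (\<omega> * (- v / (q * J) - V * q * X + u * X / J) + \<delta>) * y
      + (\<omega> * (v * V - csum (X / J) + csum (q\<^sup>2 * X * J)) - u * \<delta>)
      + (\<omega> * (- v * q * J - V / (q * X) + u * J / X) + \<delta>) / (X * y)"
  shows "(u\<^sup>2 + v\<^sup>2 - 4 - u * v * csum (q * X) + (csum (q * X))\<^sup>2) * \<omega> *
        (V - csum (q * X * Y / J)) * (V - csum (X * Y / (q * J)))
      - (X - 1 / X) * ((q + 1 / q) * (v * U + u * V) - csum X * (v * V + u * U) + \<theta> * \<omega> * csum J) *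
        (u - csum (q\<^sup>2 * X * Y)) * (V - csum (X * Y / (q * J)))
      + (U\<^sup>2 + V\<^sup>2 - 4 - U * V * csum (X / q) + (csum (X / q))\<^sup>2) * \<theta> *
        (u - csum (q\<^sup>2 * X * Y)) * (u - csum (X * Y))
    = R (q\<^sup>2 * Y) * (v - csum (q * Y)) * (V - csum (X * Y / (q * J)))
      - R Y * (U - csum (Y / J)) * (u - csum (q\<^sup>2 * X * Y))"
  unfolding R \<delta> \<theta> \<omega> csum_def using nz
  by (simp add: divide_simps) algebra

text \<open>Up to a common factor, the three terms on the left come from A(x), A(-x) and E. Their
  sum is the middle coefficient of \<open>telescoping_identity\<close> with u = csum S and V = csum
  W.\<close>

lemma middle_coefficient:
  fixes S W X J q v U :: complex
  assumes "S \<noteq> 0" "W \<noteq> 0" "X \<noteq> 0" "J \<noteq> 0" "q \<noteq> 0"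
  assumes \<omega>: "\<omega> = X / q - q / X" and \<theta>: "\<theta> = q * X - 1 / (q * X)" 
  shows "\<omega> * ((v - csum (q * S * X)) * (U - csum (q * X / W))) +
      \<theta> * ((v - csum (q * S / X)) * (U - csum (q / (X * W)))) +
      (X - 1 / X) * \<theta> * \<omega> * (csum J - csum (q * S / W)) =
    (X - 1 / X) * ((q + 1 / q) * (v * U + csum S * csum W) - csum X * (v * csum W + csum S * U) +
        \<theta> * \<omega> * csum J)"
  unfolding \<theta> \<omega> csum_def using assms(1-5)
  by (simp add: divide_simps) algebra

text \<open>csum (S y) and csum (S / y) have sum csum S * csum y and product (csum S)^2 + (csum y)^2
  - 4. This factors the outer coefficients of \<open>telescoping_identity\<close>.\<close>

lemma csum_resultant:
  assumes "S \<noteq> 0" "y \<noteq> 0"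
  shows "(v - csum (S * y)) * (v - csum (S / y)) = (csum S)\<^sup>2 + v\<^sup>2 - 4 - csum S * v * csum y + (csum y)\<^sup>2"
  unfolding csum_def using assms by (simp add: divide_simps) algebra

text \<open>The identity \<open>id\<close> is multiplied by P g / (D N'), and the recurrences turn
  the resulting multiples of P and g into P2, Pm and g2. Here P and g play the two factors of the
  integrand at z, and P2, Pm, g2 their values at z + 2 or z - 2.\<close>

lemma telescoping_step:
  fixes D :: "'a :: field"
  assumes nz: "D \<noteq> 0" "N \<noteq> 0" "N' \<noteq> 0"
    and P2: "D * P2 = N * P" and Pm: "D' * P = N' * Pm" and g2: "M2 * g2 = K * g"
    and id: "A1 * N * N' - A2 * D * N' + A3 * D * D' = R2 * K * N' - R * M * D"
  shows "A1 * (P2 * g) - A2 * (P * g) + A3 * (Pm * g) = R2 * P2 * (M2 * g2) / N - R * P * M * g / N'"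
proof -
  define x where "x = P / D"
  define y where "y = R * P * M * g / N'"
  have x: "x * D = P" and y: "y * N' = R * P * M * g"
    using nz by (simp_all add: x_def y_def)
  have "P2 = x * N"
    using P2 nz by (simp add: x_def eq_divide_eq mult.commute)
  then have 1: "R2 * P2 * (M2 * g2) / N = R2 * x * (K * g)"
    using nz by (simp add: g2)
  have "(A1 * (P2 * g) - A2 * (P * g) + A3 * (Pm * g)) * (D * N') =
      (A1 * (D * P2) * N' - A2 * D * P * N' + A3 * D * (N' * Pm)) * g"
    by algebra
  also have "\<dots> = P * g * (A1 * N * N' - A2 * D * N' + A3 * D * D')"
    unfolding P2 Pm[symmetric] by algebra
  also have "\<dots> = R2 * K * g * (x * D) * N' - (R * P * M * g) * D"
    unfolding id x by algebra
  also have "\<dots> = (R2 * x * (K * g) - y) * (D * N')"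
    unfolding y[symmetric] by algebra
  finally show ?thesis
    using nz unfolding 1 y_def by simp
qed

section \<open>The function Gamma2tau\<close>

locale imaginary_modulus =
  fixes \<tau> :: complex
  assumes Re_tau: "Re \<tau> = 0" and Im_tau: "Im \<tau> > 0"
begin

abbreviation Q :: "complex \<Rightarrow> complex" where "Q \<equiv> qpow \<tau>"

lemma tau_nonzero [simp]: "\<tau> \<noteq> 0"
  using Im_tau by auto

lemma Q_add: "Q (u + v) = Q u * Q v"
  by (simp add: qpow_def ring_distribs exp_add)

lemma Q_minus: "Q (- u) = inverse (Q u)"
  by (simp add: qpow_def exp_minus)

lemma Q_diff: "Q (u - v) = Q u / Q v"
  by (simp add: qpow_def ring_distribs exp_diff)

lemma Q_nonzero [simp]: "Q u \<noteq> 0"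
  by (simp add: qpow_def)

lemma Q_0 [simp]: "Q 0 = 1"
  by (simp add: qpow_def)

lemma Q_half_period: "Q (1 / (2 * \<tau>)) = - 1"
  by (simp add: qpow_def)

lemma Q_of_nat_mult: "Q (of_nat n * u) = Q u ^ n"
  by (induction n) (simp_all add: ring_distribs Q_add)

lemma cnj_Q: "cnj (Q u) = Q (cnj u)"
proof -
  have "cnj \<tau> = - \<tau>"
    using Re_tau by (simp add: complex_eq_iff)
  then show ?thesis
    by (simp add: qpow_def exp_cnj)
qed

lemma norm_Q: "norm (Q u) = exp (- (2 * pi * Im \<tau> * Re u))"
  using Re_tau by (simp add: qpow_def norm_exp_eq_Re)

lemma norm_Q_eq_1_iff: "norm (Q u) = 1 \<longleftrightarrow> Re u = 0"
  using Im_tau by (auto simp: norm_Q)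

lemma norm_Q_2: "norm (Q 2) < 1"
  using Im_tau by (simp add: norm_Q)

lemma holomorphic_on_Q [holomorphic_intros]:
  "f holomorphic_on A \<Longrightarrow> (\<lambda>z. Q (f z)) holomorphic_on A"
  unfolding qpow_def by (intro holomorphic_intros)

lemma Re_of_real_div_tau [simp]: "Re (1 / (2 * \<tau>)) = 0" "Re (of_real y / \<tau>) = 0" "Re (1 / \<tau>) = 0"
  using Re_tau by (simp_all add: Re_divide)

lemma Q_quarter_period: "Q (1 / (4 * \<tau>)) = \<i>"
  using cis_pi_half by (simp add: qpow_def cis_conv_exp)

lemma Q_period: "Q (1 / \<tau>) = 1"
  by (simp add: qpow_def)

text \<open>\<open>S w\<close> is -2 sinh (pi \<i> \<tau> w), and \<open>C u\<close> below is 2 cosh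
  (2 pi \<i> \<tau> u). The product formula \<open>S_mult_S\<close> links them.\<close>

definition S :: "complex \<Rightarrow> complex" where "S w = Q (- (w / 2)) - Q (w / 2)"

definition C :: "complex \<Rightarrow> complex" where "C u = Q u + Q (- u)"

lemma S_mult_S: "S (A + u) * S (A - u) = C A - C u"
proof -
  have "S (A + u) * S (A - u) =
      Q (- ((A + u) / 2) + - ((A - u) / 2)) - Q (- ((A + u) / 2) + (A - u) / 2)
      - Q ((A + u) / 2 + - ((A - u) / 2)) + Q ((A + u) / 2 + (A - u) / 2)"
    unfolding S_def Q_add by (simp add: algebra_simps)
  also have "\<dots> = C A - C u"
    by (simp add: C_def diff_divide_distrib add_divide_distrib)
  finally show ?thesis .
qed

lemma Q_eq_1_imp: "Q u = 1 \<Longrightarrow> Re u = 0"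
  using norm_Q_eq_1_iff[of u] by simp

lemma S_eq: "S w = Q (- (w / 2)) * (1 - Q w)"
  by (simp add: S_def ring_distribs flip: Q_add)

lemma S_nonzero: "Re w \<noteq> 0 \<Longrightarrow> S w \<noteq> 0"
  using Q_eq_1_imp[of w] by (auto simp: S_eq)

text \<open>By \<open>S_mult_S\<close> the difference is a product of two values of
  \<open>S\<close>, and \<open>S\<close> vanishes only on the imaginary axis. Thus nonvanishing can
  be read off from real parts.\<close>

lemma C_diff_nonzero: "\<bar>Re u\<bar> \<noteq> \<bar>Re A\<bar> \<Longrightarrow> C A - C u \<noteq> 0"
  using S_nonzero[of "A + u"] S_nonzero[of "A - u"] unfolding S_mult_S[symmetric]
  by (auto simp: abs_if split: if_splits)

lemma cnj_C: "cnj (C u) = C (cnj u)"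
  by (simp add: C_def cnj_Q)

lemma C_minus: "C (- u) = C u"
  by (simp add: C_def)

lemma holomorphic_on_C [holomorphic_intros]:
  "f holomorphic_on A \<Longrightarrow> (\<lambda>z. C (f z)) holomorphic_on A"
  unfolding C_def by (intro holomorphic_intros)

text \<open>The reciprocal is entire, and \<open>inverse 0 = 0\<close> gives it the right value 0 at
  the poles of \<open>Gamma2tau\<close>. So no pole has to be treated separately.\<close>

definition rG :: "complex \<Rightarrow> complex" where "rG x = inverse (Gamma2tau \<tau> x)"

lemma Gamma2tau_eq: "Gamma2tau \<tau> x = inverse (rG x)"
  by (simp add: rG_def)

lemma rG_eq: "rG x = qpochhammer_inf (- Q (x + 1)) (Q 2) * Q (x\<^sup>2 / 8)"
  by (simp add: rG_def Gamma2tau_def Q_minus field_simps)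

lemma holomorphic_on_rG [holomorphic_intros]:
  "f holomorphic_on A \<Longrightarrow> (\<lambda>z. rG (f z)) holomorphic_on A"
  unfolding rG_eq by (intro holomorphic_intros holomorphic_on_qpochhammer_inf norm_Q_2) auto

text \<open>A zero needs q^(x + 1 + 2 j) = -1 for some j, and comparing moduli gives Re x = -1 - 2
  j.\<close>

lemma rG_nonzero:
  assumes "Re x > - 1"
  shows "rG x \<noteq> 0"
proof -
  have "- Q (x + 1) * Q 2 ^ j \<noteq> 1" for j
  proof
    assume "- Q (x + 1) * Q 2 ^ j = 1"
    then have "norm (Q (x + 1 + of_nat j * 2)) = 1"
      by (metis Q_add Q_of_nat_mult mult_minus_left norm_minus_cancel norm_one)
    then have "Re x + 1 + 2 * real j = 0"
      by (simp add: norm_Q_eq_1_iff)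
    then show False
      using assms of_nat_0_le_iff[of j, where 'a = real] by linarith
  qed
  then show ?thesis
    by (simp add: rG_eq qpochhammer_inf_eq_0_iff[OF norm_Q_2])
qed

text \<open>The product contributes 1 + q^w and the Gaussian factor q^(-w/2).\<close>

lemma rG_rec: "rG (w - 1) = (Q (w / 2) + Q (- (w / 2))) * rG (w + 1)"
proof -
  have "qpochhammer_inf (- Q w) (Q 2) = (1 + Q w) * qpochhammer_inf (- Q (w + 2)) (Q 2)"
    using qpochhammer_inf_rec[OF norm_Q_2, of "- Q w"] by (simp add: Q_add)
  moreover have "Q ((w - 1)\<^sup>2 / 8) = Q ((w + 1)\<^sup>2 / 8) * Q (- (w / 2))"
    unfolding Q_add[symmetric] by (rule arg_cong[of _ _ Q]) (simp add: power2_eq_square field_simps)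
  moreover have "(1 + Q w) * Q (- (w / 2)) = Q (w / 2) + Q (- (w / 2))"
    by (simp add: ring_distribs flip: Q_add)
  ultimately show ?thesis
    by (simp add: rG_eq add_ac mult_ac)
qed

text \<open>Since q^(1/(4\<tau>)) = \<i>, the half period turns the cosine factor into
  \<open>S\<close>. The sign -1/(2\<tau>) occurs in \<open>f_AW\<close>, the opposite one in
  \<open>Delta_AW\<close>.\<close>

lemma rG_rec_minus: "rG (w - 1 / (2 * \<tau>) - 1) = \<i> * S w * rG (w - 1 / (2 * \<tau>) + 1)"
proof -
  have "Q ((w - 1 / (2 * \<tau>)) / 2) = Q (w / 2 - 1 / (4 * \<tau>))"
    "Q (- ((w - 1 / (2 * \<tau>)) / 2)) = Q (- (w / 2) + 1 / (4 * \<tau>))"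
    by (simp_all add: diff_divide_distrib)
  then show ?thesis
    unfolding rG_rec Q_add Q_diff Q_quarter_period by (simp add: S_def algebra_simps divide_i)
qed

lemma rG_rec_plus: "rG (w + 1 / (2 * \<tau>) - 1) = - \<i> * S w * rG (w + 1 / (2 * \<tau>) + 1)"
proof -
  have "Q ((w + 1 / (2 * \<tau>)) / 2) = Q (w / 2 + 1 / (4 * \<tau>))"
    "Q (- ((w + 1 / (2 * \<tau>)) / 2)) = Q (- (w / 2) - 1 / (4 * \<tau>))"
    by (simp_all add: add_divide_distrib)
  then show ?thesis
    unfolding rG_rec Q_add Q_diff Q_quarter_period by (simp add: S_def algebra_simps divide_i)
qed

text \<open>The product is periodic, so only the Gaussian factor produces a multiplier.\<close>

lemma rG_add_period: "rG (x + 1 / \<tau>) = rG x * Q (x / (4 * \<tau>) + 1 / (8 * \<tau>\<^sup>2))"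
proof -
  have "Q ((x + 1 / \<tau>)\<^sup>2 / 8) = Q (x\<^sup>2 / 8) * Q (x / (4 * \<tau>) + 1 / (8 * \<tau>\<^sup>2))"
    unfolding Q_add[symmetric] by (rule arg_cong[of _ _ Q]) (simp add: power2_eq_square field_simps)
  moreover have "Q (x + 1 / \<tau> + 1) = Q (x + 1)"
    by (simp add: Q_add Q_period)
  ultimately show ?thesis
    unfolding rG_eq by simp
qed

lemma rG_diff_period: "rG (x - 1 / \<tau>) = rG x * Q (- x / (4 * \<tau>) + 1 / (8 * \<tau>\<^sup>2))"
proof -
  have "Q ((x - 1 / \<tau>)\<^sup>2 / 8) = Q (x\<^sup>2 / 8) * Q (- x / (4 * \<tau>) + 1 / (8 * \<tau>\<^sup>2))"
    unfolding Q_add[symmetric] by (rule arg_cong[of _ _ Q]) (simp add: power2_eq_square field_simps)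
  moreover have "Q (x - 1 / \<tau> + 1) = Q (x + 1)"
    by (simp add: Q_add Q_diff Q_period)
  ultimately show ?thesis
    unfolding rG_eq by simp
qed

section \<open>The eigenfunctions f_AW\<close>

text \<open>The arguments are put into the shape of \<open>rG_rec_minus\<close>, so that z and z + 2
  can be reduced to the same four values of \<open>rG\<close>.\<close>

lemma f_AW_eq: "f_AW \<tau> lam z \<alpha> \<rho> =
  (rG ((of_real \<alpha> + of_real \<rho> + \<i> * of_real lam - z) - 1 / (2 * \<tau>) + 1) *
    rG ((of_real \<rho> + \<i> * of_real lam + z + 1) - 1 / (2 * \<tau>) - 1)) /
  (rG ((of_real \<alpha> + of_real \<rho> - \<i> * of_real lam + z) - 1 / (2 * \<tau>) - 1) *
    rG ((of_real \<rho> - \<i> * of_real lam - z - 1) - 1 / (2 * \<tau>) + 1))"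
proof -
  have args: "1 - 1 / (2 * \<tau>) + of_real \<alpha> + of_real \<rho> + \<i> * of_real lam - z =
      (of_real \<alpha> + of_real \<rho> + \<i> * of_real lam - z) - 1 / (2 * \<tau>) + 1"
    "- (1 / (2 * \<tau>)) + of_real \<rho> + \<i> * of_real lam + z =
        (of_real \<rho> + \<i> * of_real lam + z + 1) - 1 / (2 * \<tau>) - 1"
    "- 1 - 1 / (2 * \<tau>) + of_real \<alpha> + of_real \<rho> - \<i> * of_real lam + z =
        (of_real \<alpha> + of_real \<rho> - \<i> * of_real lam + z) - 1 / (2 * \<tau>) - 1"
    "- (1 / (2 * \<tau>)) + of_real \<rho> - \<i> * of_real lam - z =
        (of_real \<rho> - \<i> * of_real lam - z - 1) - 1 / (2 * \<tau>) + 1"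
    by simp_all
  show ?thesis
    unfolding f_AW_def Gamma2tau_eq args
    by (simp only: divide_inverse inverse_mult_distrib inverse_inverse_eq mult_ac)
qed

text \<open>Each of the four \<open>rG\<close> factors contributes one \<open>S\<close> to the
  quotient f(z + 2) / f(z) = S1 S3 / (S2 S4), and \<open>S_mult_S\<close> merges them in pairs. The
  hypotheses give S3 and S4 nonzero.\<close>

lemma f_AW_rec:
  assumes "\<bar>Re z + 1\<bar> \<noteq> \<bar>\<rho>\<bar>" "\<bar>Re z\<bar> \<noteq> \<bar>\<alpha> + \<rho>\<bar>"
  shows "(C (of_real \<rho>) - C (z + 1 + \<i> * of_real lam)) * f_AW \<tau> lam (z + 2) \<alpha> \<rho> =
    (C (of_real \<alpha> + of_real \<rho>) - C (z - \<i> * of_real lam)) * f_AW \<tau> lam z \<alpha> \<rho>"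
proof -
  define n1 n2 d1 d2 where
    "n1 = rG ((of_real \<alpha> + of_real \<rho> + \<i> * of_real lam - z) - 1 / (2 * \<tau>) + 1)" and
    "n2 = rG ((of_real \<rho> + \<i> * of_real lam + z + 1) - 1 / (2 * \<tau>) + 1)" and
    "d1 = rG ((of_real \<alpha> + of_real \<rho> - \<i> * of_real lam + z) - 1 / (2 * \<tau>) + 1)" and
    "d2 = rG ((of_real \<rho> - \<i> * of_real lam - z - 1) - 1 / (2 * \<tau>) + 1)"
  define S1 S2 S3 S4 where
    "S1 = S (of_real \<alpha> + of_real \<rho> + \<i> * of_real lam - z)" and
    "S2 = S (of_real \<rho> + \<i> * of_real lam + z + 1)" and
    "S3 = S (of_real \<alpha> + of_real \<rho> - \<i> * of_real lam + z)" and
    "S4 = S (of_real \<rho> - \<i> * of_real lam - z - 1)"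
  have "Re (of_real \<alpha> + of_real \<rho> - \<i> * of_real lam + z) \<noteq> 0" "Re (of_real \<rho> - \<i> * of_real lam - z - 1) \<noteq> 0"
    using assms by auto
  then have nz: "S3 \<noteq> 0" "S4 \<noteq> 0"
    unfolding S3_def S4_def by - (rule S_nonzero, assumption)+
  have f0: "f_AW \<tau> lam z \<alpha> \<rho> = (n1 * (\<i> * S2 * n2)) / ((\<i> * S3 * d1) * d2)"
    unfolding f_AW_eq rG_rec_minus by (simp only: n1_def n2_def d1_def d2_def S2_def S3_def)
  have f2: "f_AW \<tau> lam (z + 2) \<alpha> \<rho> = ((\<i> * S1 * n1) * n2) / (d1 * (\<i> * S4 * d2))"
  proof -
    have "(of_real \<alpha> + of_real \<rho> + \<i> * of_real lam - (z + 2)) - 1 / (2 * \<tau>) + 1 =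
        (of_real \<alpha> + of_real \<rho> + \<i> * of_real lam - z) - 1 / (2 * \<tau>) - 1"
      "(of_real \<rho> + \<i> * of_real lam + (z + 2) + 1) - 1 / (2 * \<tau>) - 1 =
          (of_real \<rho> + \<i> * of_real lam + z + 1) - 1 / (2 * \<tau>) + 1"
      "(of_real \<alpha> + of_real \<rho> - \<i> * of_real lam + (z + 2)) - 1 / (2 * \<tau>) - 1 =
          (of_real \<alpha> + of_real \<rho> - \<i> * of_real lam + z) - 1 / (2 * \<tau>) + 1"
      "(of_real \<rho> - \<i> * of_real lam - (z + 2) - 1) - 1 / (2 * \<tau>) + 1 =
          (of_real \<rho> - \<i> * of_real lam - z - 1) - 1 / (2 * \<tau>) - 1"
      by (simp_all add: algebra_simps)
    then show ?thesis
      unfolding f_AW_eq by (simp only: rG_rec_minus n1_def n2_def d1_def d2_def S1_def S4_def)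
  qed
  have S24: "C (of_real \<rho>) - C (z + 1 + \<i> * of_real lam) = S2 * S4"
    unfolding S_mult_S[symmetric] S2_def S4_def by (simp add: algebra_simps)
  have S13: "C (of_real \<alpha> + of_real \<rho>) - C (z - \<i> * of_real lam) = S1 * S3"
    unfolding S_mult_S[symmetric] S1_def S3_def by (simp add: algebra_simps)
  \<comment> \<open>\<open>j\<close> stands for \<i>, which is only cancelled here and never
    multiplied out.\<close>
  have "(S2 * S4) * ((j * S1 * n1) * n2 / (d1 * (j * S4 * d2))) =
      (S1 * S3) * ((n1 * (j * S2 * n2)) / ((j * S3 * d1) * d2))"
    if "j \<noteq> 0" for j
  proof -
    have "(S2 * S4) * ((j * S1 * n1) * n2 / (d1 * (j * S4 * d2))) =
        ((j * S4) * (S1 * S2 * n1 * n2)) / ((j * S4) * (d1 * d2))"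
      by (simp only: times_divide_eq_right mult_ac)
    also have "\<dots> = ((j * S3) * (S1 * S2 * n1 * n2)) / ((j * S3) * (d1 * d2))"
      using that nz by (subst (1 2) nonzero_mult_divide_mult_cancel_left) auto
    also have "\<dots> = (S1 * S3) * ((n1 * (j * S2 * n2)) / ((j * S3 * d1) * d2))"
      by (simp only: times_divide_eq_right mult_ac)
    finally show ?thesis .
  qed
  note key = this[OF complex_i_not_zero]
  show ?thesis
    by (subst f0, subst f2, subst S24, subst S13) (rule key)
qed

text \<open>This power of q is (-1)^n; evenness of \<alpha> and \<beta> becomes periodicity of
  \<open>f_AW\<close> and \<open>Delta_AW\<close> through it.\<close>

lemma Q_even: "even n \<Longrightarrow> Q (of_real (real n) / (2 * \<tau>)) = 1"
  using Q_of_nat_mult[of n "1 / (2 * \<tau>)"] by (simp add: Q_half_period)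

text \<open>In the product of the four multipliers z, \<rho> and \<open>lam\<close> cancel, and
  q^(-\<alpha>/(2\<tau>)) remains.\<close>

lemma f_AW_periodic:
  assumes "Q (of_real \<alpha> / (2 * \<tau>)) = 1"
  shows "f_AW \<tau> lam (z + 1 / \<tau>) \<alpha> \<rho> = f_AW \<tau> lam z \<alpha> \<rho>"
proof -
  define w1 w2 w3 w4 where
    "w1 = (of_real \<alpha> + of_real \<rho> + \<i> * of_real lam - z) - 1 / (2 * \<tau>) + 1" and
    "w2 = (of_real \<rho> + \<i> * of_real lam + z + 1) - 1 / (2 * \<tau>) - 1" and
    "w3 = (of_real \<alpha> + of_real \<rho> - \<i> * of_real lam + z) - 1 / (2 * \<tau>) - 1" and
    "w4 = (of_real \<rho> - \<i> * of_real lam - z - 1) - 1 / (2 * \<tau>) + 1"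
  let ?e = "1 / (8 * \<tau>\<^sup>2)"
  have "f_AW \<tau> lam (z + 1 / \<tau>) \<alpha> \<rho> =
      (rG (w1 - 1 / \<tau>) * rG (w2 + 1 / \<tau>)) / (rG (w3 + 1 / \<tau>) * rG (w4 - 1 / \<tau>))"
    unfolding f_AW_eq w1_def w2_def w3_def w4_def by (simp add: algebra_simps)
  also have "\<dots> = (rG w1 * rG w2) / (rG w3 * rG w4) *
      ((Q (- w1 / (4 * \<tau>) + ?e) * Q (w2 / (4 * \<tau>) + ?e)) /
       (Q (w3 / (4 * \<tau>) + ?e) * Q (- w4 / (4 * \<tau>) + ?e)))"
    unfolding rG_add_period rG_diff_period by (simp add: mult_ac)
  finally have *: "f_AW \<tau> lam (z + 1 / \<tau>) \<alpha> \<rho> = (rG w1 * rG w2) / (rG w3 * rG w4) *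
      ((Q (- w1 / (4 * \<tau>) + ?e) * Q (w2 / (4 * \<tau>) + ?e)) /
       (Q (w3 / (4 * \<tau>) + ?e) * Q (- w4 / (4 * \<tau>) + ?e)))" .
  have "(Q (- w1 / (4 * \<tau>) + ?e) * Q (w2 / (4 * \<tau>) + ?e)) /
       (Q (w3 / (4 * \<tau>) + ?e) * Q (- w4 / (4 * \<tau>) + ?e)) =
       Q (- (of_real \<alpha> / (2 * \<tau>)))"
  proof -
    have "(- w1 / (4 * \<tau>) + ?e + (w2 / (4 * \<tau>) + ?e)) - (w3 / (4 * \<tau>) + ?e + (- w4 / (4 * \<tau>) + ?e)) =
        (w2 - w1 - w3 + w4) / (4 * \<tau>)"
      by (simp add: add_divide_distrib diff_divide_distrib)
    also have "w2 - w1 - w3 + w4 = - 2 * of_real \<alpha>"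
      by (simp add: w1_def w2_def w3_def w4_def)
    also have "- 2 * of_real \<alpha> / (4 * \<tau>) = - (of_real \<alpha> / (2 * \<tau>))"
      by simp
    finally show ?thesis
      unfolding Q_add[symmetric] Q_diff[symmetric] by (rule arg_cong)
  qed
  also have "\<dots> = 1"
    using assms by (simp add: Q_minus)
  finally show ?thesis
    unfolding * by (simp add: f_AW_eq w1_def w2_def w3_def w4_def)
qed

text \<open>The bounds keep both denominator arguments in the half plane Re > -1, where
  \<open>rG\<close> has no zeros.\<close>

lemma holomorphic_on_f_AW:
  assumes "f holomorphic_on A"
    and "\<And>z. z \<in> A \<Longrightarrow> - \<alpha> - \<rho> < Re (f z) \<and> Re (f z) < \<rho> + 1"
  shows "(\<lambda>z. f_AW \<tau> lam (f z) \<alpha> \<rho>) holomorphic_on A"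
  unfolding f_AW_eq
proof (intro holomorphic_intros assms(1))
  show "rG ((of_real \<alpha> + of_real \<rho> - \<i> * of_real lam + f z) - 1 / (2 * \<tau>) - 1) *
      rG ((of_real \<rho> - \<i> * of_real lam - f z - 1) - 1 / (2 * \<tau>) + 1) \<noteq> 0" if "z \<in> A" for z
  proof -
    have "rG ((of_real \<alpha> + of_real \<rho> - \<i> * of_real lam + f z) - 1 / (2 * \<tau>) - 1) \<noteq> 0"
    "rG ((of_real \<rho> - \<i> * of_real lam - f z - 1) - 1 / (2 * \<tau>) + 1) \<noteq> 0"
    using assms(2)[of z] that by (auto intro!: rG_nonzero)
    then show ?thesis by simp
  qed
qed

section \<open>Shifting the contour\<close>

text \<open>
  The integral equals \<open>\<tau> (G (s + 1/\<tau>) - G s)\<close> for a primitive \<open>G\<close> of \<open>h\<close> on the strip, and the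
  derivative of this in \<open>s\<close> vanishes by periodicity.
\<close>
lemma integral_period_shift:
  assumes hol: "h holomorphic_on {z. a < Re z \<and> Re z < b}"
    and per: "\<And>z. a < Re z \<Longrightarrow> Re z < b \<Longrightarrow> h (z + 1 / \<tau>) = h z"
    and s: "a < Re s" "Re s < b" and t: "a < Re t" "Re t < b"
  shows "integral {0..1} (\<lambda>y. h (s + of_real y / \<tau>)) = integral {0..1} (\<lambda>y. h (t + of_real y / \<tau>))"
proof -
  define A where "A = {z. a < Re z \<and> Re z < b}"
  have A_eq: "A = {z. a < Re z} \<inter> {z. Re z < b}"
    by (auto simp: A_def)
  have "convex A" "open A"
    unfolding A_eq by (intro convex_Int convex_halfspace_Re_gt convex_halfspace_Re_lt
      open_Int open_halfspace_Re_gt open_halfspace_Re_lt)+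
  with hol obtain G where "\<And>z. z \<in> A \<Longrightarrow> (G has_field_derivative h z) (at z within A)"
    using holomorphic_convex_primitive'[of A h] unfolding A_def by blast
  then have G: "(G has_field_derivative h z) (at z)" if "z \<in> A" for z
    using that \<open>open A\<close> by (metis at_within_open)
  have shift: "z + of_real y / \<tau> \<in> A" "z + 1 / \<tau> \<in> A" if "z \<in> A" for z y
    using that by (auto simp: A_def)
  have "integral {0..1} (\<lambda>y. h (z + of_real y / \<tau>)) = \<tau> * (G (z + 1 / \<tau>) - G z)"
    if "z \<in> A" for z
  proof -
    have "((\<lambda>y. \<tau> * G (z + of_real y / \<tau>)) has_vector_derivative
        h (z + of_real y / \<tau>)) (at y within {0..1})" for y
    proof -
      have "((\<lambda>w. \<tau> * G (z + w / \<tau>)) has_field_derivative h (z + of_real y / \<tau>)) (at (of_real y))"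
        by (rule derivative_eq_intros DERIV_chain2[OF G] refl shift that | simp)+
      then show ?thesis
        using has_vector_derivative_real_field by blast
    qed
    from fundamental_theorem_of_calculus[OF zero_le_one this] show ?thesis
      by (simp add: right_diff_distrib integral_unique)
  qed
  moreover have "\<exists>c. \<forall>z\<in>A. G (z + 1 / \<tau>) - G z = c"
  proof (rule has_field_derivative_zero_constant[OF \<open>convex A\<close>])
    show "((\<lambda>z. G (z + 1 / \<tau>) - G z) has_field_derivative 0) (at z within A)" if "z \<in> A" for z
    proof -
      have "((\<lambda>z. G (z + 1 / \<tau>) - G z) has_field_derivative (h (z + 1 / \<tau>) * 1 - h z)) (at z)"
        by (rule derivative_eq_intros DERIV_chain2[OF G] G refl shift that | simp)+
      then show ?thesis
        using per that by (auto simp: A_def intro: has_field_derivative_at_within)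
    qed
  qed
  moreover have "s \<in> A" "t \<in> A"
    using s t by (auto simp: A_def)
  ultimately show ?thesis
    by metis
qed

section \<open>The three term relation\<close>

lemma C_eq_csum: "C u = csum (Q u)"
  by (simp add: C_def csum_def Q_minus divide_inverse)

lemma Q_2_eq: "Q 2 = (Q 1)\<^sup>2"
  using Q_of_nat_mult[of 2 1] by simp

text \<open>
  The holomorphic extension of the complex conjugate of \<open>f_AW\<close> from the imaginary axis.
\<close>
definition g_AW :: "real \<Rightarrow> complex \<Rightarrow> real \<Rightarrow> real \<Rightarrow> complex"
  where "g_AW lam z \<alpha> \<rho> = cnj (f_AW \<tau> lam (- cnj z) \<alpha> \<rho>)"

text \<open>This is the conjugate of \<open>f_AW_rec\<close> at w = - cnj z - 2. The reflection
  sends z + 2 to w and z to w + 2, so the two coefficients change sides.\<close>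

lemma g_AW_rec:
  assumes "\<bar>Re z + 1\<bar> \<noteq> \<bar>\<rho>\<bar>" "\<bar>Re z + 2\<bar> \<noteq> \<bar>\<alpha> + \<rho>\<bar>"
  shows "(C (of_real \<alpha> + of_real \<rho>) - C (z + 2 - \<i> * of_real lam)) * g_AW lam (z + 2) \<alpha> \<rho> =
    (C (of_real \<rho>) - C (z + 1 + \<i> * of_real lam)) * g_AW lam z \<alpha> \<rho>"
proof -
  define w where "w = - cnj z - 2"
  have args: "- cnj (z + 2) = w" "- cnj z = w + 2"
    and cnj_args: "cnj (w - \<i> * of_real lam) = - (z + 2 - \<i> * of_real lam)"
      "cnj (w + 1 + \<i> * of_real lam) = - (z + 1 + \<i> * of_real lam)"
    by (simp_all add: w_def)
  have "(C (of_real \<rho>) - C (w + 1 + \<i> * of_real lam)) * f_AW \<tau> lam (w + 2) \<alpha> \<rho> =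
      (C (of_real \<alpha> + of_real \<rho>) - C (w - \<i> * of_real lam)) * f_AW \<tau> lam w \<alpha> \<rho>"
    by (rule f_AW_rec) (use assms in \<open>auto simp: w_def abs_if split: if_splits\<close>)
  from this[THEN arg_cong[of _ _ cnj]] show ?thesis
    unfolding complex_cnj_mult complex_cnj_diff[of "C _"] cnj_C cnj_args C_minus g_AW_def args
    by simp
qed

lemma g_AW_periodic:
  assumes "Q (of_real \<alpha> / (2 * \<tau>)) = 1"
  shows "g_AW lam (z + 1 / \<tau>) \<alpha> \<rho> = g_AW lam z \<alpha> \<rho>"
proof -
  have "cnj \<tau> = - \<tau>"
    using Re_tau by (simp add: complex_eq_iff)
  then have "- cnj (z + 1 / \<tau>) = - cnj z + 1 / \<tau>"
    by simp
  then show ?thesis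
    unfolding g_AW_def by (simp only: f_AW_periodic[OF assms])
qed

text \<open>By Schwarz reflection, conjugating both the argument and the value of f(-z) preserves
  holomorphy; the strip is the mirror image of that for \<open>f_AW\<close>.\<close>

lemma holomorphic_on_g_AW:
  assumes "open A" and "\<And>z. z \<in> A \<Longrightarrow> - \<rho> - 1 < Re z \<and> Re z < \<alpha> + \<rho>"
  shows "(\<lambda>z. g_AW lam z \<alpha> \<rho>) holomorphic_on A"
proof -
  have "(\<lambda>z. f_AW \<tau> lam (- z) \<alpha> \<rho>) holomorphic_on cnj ` A"
    using assms(2) by (intro holomorphic_on_f_AW holomorphic_intros) fastforce
  from holomorphic_on_compose_cnj_cnj[OF this assms(1)] show ?thesis
    by (simp add: o_def g_AW_def)
qed

text \<open>On the imaginary axis - cnj z = z, so the conjugate may be replaced by its holomorphic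
  extension.\<close>

lemma phi_AW_eq: "phi_AW \<tau> \<alpha> \<beta> \<rho> \<sigma> lam x = integral {0..1} (\<lambda>y.
    f_AW \<tau> lam (1 + x + of_real y / \<tau>) \<beta> \<sigma> * g_AW lam (of_real y / \<tau>) \<alpha> \<rho>)"
proof -
  have "cnj \<tau> = - \<tau>"
    using Re_tau by (simp add: complex_eq_iff)
  then show ?thesis
    by (simp add: phi_AW_def g_AW_def)
qed

lemma phi_AW_integrable:
  assumes "\<bar>Re x\<bar> \<le> 2" "\<alpha> \<ge> 0" "\<beta> \<ge> 0" "\<rho> \<ge> 3" "\<sigma> \<ge> 3"
  shows "(\<lambda>y. f_AW \<tau> lam (1 + x + of_real y / \<tau>) \<beta> \<sigma> * g_AW lam (of_real y / \<tau>) \<alpha> \<rho>) integrable_on {0..1}"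
proof (rule integrable_continuous_real)
  \<comment> \<open>For z in this strip 1 + x + z has real part between -2 and 7/2, inside the strip
    of holomorphy because \<sigma> >= 3.\<close>
  define A where "A = {z. - 1 < Re z} \<inter> {z. Re z < 1 / 2}"
  have "open A"
    unfolding A_def by (intro open_Int open_halfspace_Re_gt open_halfspace_Re_lt)
  have "(\<lambda>z. f_AW \<tau> lam (1 + x + z) \<beta> \<sigma> * g_AW lam z \<alpha> \<rho>) holomorphic_on A"
    using assms \<open>open A\<close>
    by (intro holomorphic_intros holomorphic_on_f_AW holomorphic_on_g_AW) (auto simp: A_def)
  then have "continuous_on A (\<lambda>z. f_AW \<tau> lam (1 + x + z) \<beta> \<sigma> * g_AW lam z \<alpha> \<rho>)"
    by (rule holomorphic_on_imp_continuous_on)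
  then show "continuous_on {0..1} (\<lambda>y. f_AW \<tau> lam (1 + x + of_real y / \<tau>) \<beta> \<sigma> *
      g_AW lam (of_real y / \<tau>) \<alpha> \<rho>)"
    by (rule continuous_on_compose2[where f = "\<lambda>y::real. of_real y / \<tau>"])
      (auto simp: A_def intro!: continuous_intros)
qed

text \<open>The coefficients are those of \<open>telescoping_identity\<close>. They do not depend on
  y, so the telescoped integrands can be integrated over a period.\<close>

lemma phi_AW_contiguous:
  fixes \<alpha> \<beta> \<rho> \<sigma> lam :: real
  assumes x: "Re x = 0" and pos: "\<alpha> \<ge> 1" "\<beta> \<ge> 1" "\<rho> \<ge> 3" "\<sigma> \<ge> 3"
    and per: "Q (of_real \<alpha> / (2 * \<tau>)) = 1" "Q (of_real \<beta> / (2 * \<tau>)) = 1"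
    and defs: "q = Q 1" "X = Q x" "J = Q (2 * \<i> * of_real lam)" "\<omega> = X / q - q / X"
        "\<theta> = q * X - 1 / (q * X)"
      "u = C (of_real \<sigma>)" "v = C (of_real \<rho>)" "U = C (of_real \<alpha> + of_real \<rho>)"
          "V = C (of_real \<beta> + of_real \<sigma>)"
  shows "(u\<^sup>2 + v\<^sup>2 - 4 - u * v * csum (q * X) + (csum (q * X))\<^sup>2) * \<omega> * phi_AW \<tau> \<alpha> \<beta> \<rho> \<sigma> lam (x + 2)
      - (X - 1 / X) * ((q + 1 / q) * (v * U + u * V) - csum X * (v * V + u * U) + \<theta> * \<omega> * csum J) *
        phi_AW \<tau> \<alpha> \<beta> \<rho> \<sigma> lam x
      + (U\<^sup>2 + V\<^sup>2 - 4 - U * V * csum (X / q) + (csum (X / q))\<^sup>2) * \<theta> * phi_AW \<tau> \<alpha> \<beta> \<rho> \<sigma> lam (x - 2) = 0"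
    (is "?A1 * phi_AW _ _ _ _ _ _ _ - ?A2 * _ + ?A3 * _ = 0")
proof -
  define \<delta> where "\<delta> = \<theta> * U - V * (q\<^sup>2 - 1 / q\<^sup>2)"
  define R where "R = (\<lambda>y. X * (\<omega> * (- v / (q * J) - V * q * X + u * X / J) + \<delta>) * y
      + (\<omega> * (v * V - csum (X / J) + csum (q\<^sup>2 * X * J)) - u * \<delta>)
      + (\<omega> * (- v * q * J - V / (q * X) + u * J / X) + \<delta>) / (X * y))"
  define P where "P = (\<lambda>z. f_AW \<tau> lam (1 + x + z) \<beta> \<sigma>)"
  define g where "g = (\<lambda>z. g_AW lam z \<alpha> \<rho>)"
  define D where "D = (\<lambda>z. u - C (z + x + 2 + \<i> * of_real lam))"
  define N where "N = (\<lambda>z. V - C (z + 1 + x - \<i> * of_real lam))"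
  define M where "M = (\<lambda>z. U - C (z - \<i> * of_real lam))"
  \<comment> \<open>The certificate of the telescoping: at z + 2 its denominator is
    \<open>N z\<close>, and \<open>M (z + 2) * g (z + 2)\<close> is a multiple of \<open>g z\<close>
    by \<open>g_AW_rec\<close>.\<close>
  define h where "h = (\<lambda>z. R (Q (z + \<i> * of_real lam)) * P z * (M z * g z) / N (z - 2))"
  have nz: "q \<noteq> 0" "X \<noteq> 0" "J \<noteq> 0"
    by (simp_all add: defs)
  have N_nz: "N z \<noteq> 0" if "\<bar>Re z + 1\<bar> < 4" for z
    unfolding N_def defs using that x pos by (intro C_diff_nonzero) auto
  have P_rec: "D z * P (z + 2) = N z * P z" if "\<bar>Re z + 1\<bar> < 4" "\<bar>Re z + 2\<bar> \<noteq> \<sigma>" for z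
  proof -
    have args: "z + x + 2 + \<i> * of_real lam = (1 + x + z) + 1 + \<i> * of_real lam"
      "z + 1 + x - \<i> * of_real lam = (1 + x + z) - \<i> * of_real lam" "1 + x + (z + 2) = (1 + x + z) + 2"
      by simp_all
    show ?thesis
      unfolding P_def D_def N_def defs args
      by (rule f_AW_rec) (use that x pos in \<open>auto simp: add_ac\<close>)
  qed
  have step: "?A1 * (P (z + 2) * g z) - ?A2 * (P z * g z) + ?A3 * (P (z - 2) * g z) = h (z + 2) - h z"
    if z: "Re z = 0" for z
  proof -
    \<comment> \<open>With this centring \<open>D\<close> and the coefficient of \<open>g z\<close>
      depend on Y alone, while z - \<i> lam corresponds to Y / J.\<close>
    define Y where "Y = Q (z + \<i> * of_real lam)"
    have Y: "Y \<noteq> 0" "Q (z + 2 + \<i> * of_real lam) = q\<^sup>2 * Y"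
      unfolding Y_def defs Q_2_eq[symmetric] Q_add[symmetric] by (simp_all add: add_ac)
    have 1: "D z = u - csum (q\<^sup>2 * X * Y)"
      unfolding D_def C_eq_csum Y_def defs Q_2_eq[symmetric] Q_add[symmetric] by (simp add: add_ac)
    have 2: "D (z - 2) = u - csum (X * Y)"
      unfolding D_def C_eq_csum Y_def defs Q_add[symmetric] by (simp add: algebra_simps)
    have 3: "N z = V - csum (q * X * Y / J)"
      unfolding N_def C_eq_csum Y_def defs Q_add[symmetric] Q_diff[symmetric] by (simp add: algebra_simps)
    have 4: "N (z - 2) = V - csum (X * Y / (q * J))"
      unfolding N_def C_eq_csum Y_def defs Q_add[symmetric] Q_diff[symmetric] by (simp add: algebra_simps)
    have 5: "M z = U - csum (Y / J)"
      unfolding M_def C_eq_csum Y_def defs Q_add[symmetric] Q_diff[symmetric] by (simp add: algebra_simps)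
    have 6: "C (z + 1 + \<i> * of_real lam) = csum (q * Y)"
      unfolding C_eq_csum Y_def defs Q_add[symmetric] by (simp add: algebra_simps)
    have "?A1 * (P (z + 2) * g z) - ?A2 * (P z * g z) + ?A3 * (P (z - 2) * g z) =
        R (q\<^sup>2 * Y) * P (z + 2) * (M (z + 2) * g (z + 2)) / N z - R Y * P z * M z * g z / N (z - 2)"
    proof (rule telescoping_step[where D' = "D (z - 2)" and K = "v - csum (q * Y)"])
      show "D z \<noteq> 0"
        unfolding D_def defs using z x pos by (intro C_diff_nonzero) auto
      show "N z \<noteq> 0" "N (z - 2) \<noteq> 0"
        using z by (auto intro!: N_nz)
      show "D z * P (z + 2) = N z * P z"
        using z pos by (intro P_rec) auto
      show "D (z - 2) * P z = N (z - 2) * P (z - 2)"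
        using P_rec[of "z - 2"] z pos by auto
      show "M (z + 2) * g (z + 2) = (v - csum (q * Y)) * g z"
        unfolding M_def g_def defs(7,8) 6[symmetric] using z pos by (intro g_AW_rec) auto
      show "?A1 * N z * N (z - 2) - ?A2 * D z * N (z - 2) + ?A3 * D z * D (z - 2) =
          R (q\<^sup>2 * Y) * (v - csum (q * Y)) * N (z - 2) - R Y * M z * D z"
        unfolding 1 2 3 4 5
        by (rule telescoping_identity[OF nz(2) Y(1) nz(3,1) defs(4,5) \<delta>_def]) (simp only: R_def)
    qed
    then show ?thesis
      unfolding h_def Y(2) by (simp add: Y_def mult.assoc)
  qed
  \<comment> \<open>The strip contains both lines Re z = 0 and Re z = 2. On it 1 + x + z has real
    part below 7/2 < \<sigma> + 1, and \<open>N (z - 2)\<close> does not vanish.\<close>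
  define A where "A = {z. - 1 < Re z \<and> Re z < 5 / 2}"
  have hol: "h holomorphic_on A"
  proof -
    have "A = {z. - 1 < Re z} \<inter> {z. Re z < 5 / 2}"
      by (auto simp: A_def)
    then have "open A"
      by (simp only: open_Int open_halfspace_Re_gt open_halfspace_Re_lt)
    moreover have "V - C (z - 2 + 1 + x - \<i> * of_real lam) \<noteq> 0" if "z \<in> A" for z
    proof -
      have "N (z - 2) \<noteq> 0"
        by (rule N_nz) (use that in \<open>auto simp: A_def abs_less_iff\<close>)
      then show ?thesis
        by (simp only: N_def not_False_eq_True)
    qed
    ultimately show ?thesis
      unfolding h_def R_def P_def g_def M_def N_def using nz pos x
      by (intro holomorphic_intros holomorphic_on_f_AW holomorphic_on_g_AW) (auto simp: A_def)
  qed
  have h_periodic: "h (z + 1 / \<tau>) = h z" for z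
  proof -
    have Q_shift: "Q (z + 1 / \<tau> + e) = Q (z + e)" for e
      by (simp add: Q_add Q_period)
    have C_shift: "C (z + 1 / \<tau> + e) = C (z + e)" for e
      by (simp add: C_eq_csum Q_shift)
    have args: "z + 1 / \<tau> - \<i> * of_real lam = z + 1 / \<tau> + (- \<i> * of_real lam)"
      "z - \<i> * of_real lam = z + (- \<i> * of_real lam)"
      "z + 1 / \<tau> - 2 + 1 + x - \<i> * of_real lam = z + 1 / \<tau> + (x - 1 - \<i> * of_real lam)"
      "z - 2 + 1 + x - \<i> * of_real lam = z + (x - 1 - \<i> * of_real lam)"
      "1 + x + (z + 1 / \<tau>) = (1 + x + z) + 1 / \<tau>"
      by simp_all
    show ?thesis
      unfolding h_def P_def g_def M_def N_def args Q_shift C_shift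
        f_AW_periodic[OF per(2)] g_AW_periodic[OF per(1)] ..
  qed
  have h_integral: "((\<lambda>y. h (s + of_real y / \<tau>))
      has_integral integral {0..1} (\<lambda>y. h (of_real y / \<tau>))) {0..1}"
    if "s = 0 \<or> s = 2" for s
  proof -
    have "continuous_on {0..1} (\<lambda>y::real. h (s + of_real y / \<tau>))"
      by (rule continuous_on_compose2[OF holomorphic_on_imp_continuous_on[OF hol]])
        (use that in \<open>auto simp: A_def intro!: continuous_intros\<close>)
    moreover have "integral {0..1} (\<lambda>y. h (s + of_real y / \<tau>)) =
        integral {0..1} (\<lambda>y. h (0 + of_real y / \<tau>))"
      by (rule integral_period_shift[OF hol[unfolded A_def] h_periodic]) (use that in auto)
    ultimately show ?thesis
      by (simp add: integrable_continuous_real has_integral_iff)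
  qed
  have phi: "((\<lambda>y. P (of_real y / \<tau> + e) * g (of_real y / \<tau>))
      has_integral phi_AW \<tau> \<alpha> \<beta> \<rho> \<sigma> lam (x + e)) {0..1}"
    if "\<bar>Re e\<bar> \<le> 2" for e
  proof -
    have args: "1 + x + (w + e) = 1 + (x + e) + w" for w
      by simp
    show ?thesis
      unfolding P_def g_def phi_AW_eq args
      by (rule integrable_integral, rule phi_AW_integrable) (use x pos that in auto)
  qed
  \<comment> \<open>The same integral is evaluated twice: by linearity through \<open>phi\<close>,
    and as the difference of the integrals of \<open>h\<close> along Re z = 2 and Re z = 0.\<close>
  have "((\<lambda>y. ?A1 * (P (of_real y / \<tau> + 2) * g (of_real y / \<tau>)) -
      ?A2 * (P (of_real y / \<tau>) * g (of_real y / \<tau>))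
        + ?A3 * (P (of_real y / \<tau> - 2) * g (of_real y / \<tau>))) has_integral
      ?A1 * phi_AW \<tau> \<alpha> \<beta> \<rho> \<sigma> lam (x + 2) - ?A2 * phi_AW \<tau> \<alpha> \<beta> \<rho> \<sigma> lam x
        + ?A3 * phi_AW \<tau> \<alpha> \<beta> \<rho> \<sigma> lam (x - 2)) {0..1}"
    using phi[of 2] phi[of 0] phi[of "- 2"]
    by (intro has_integral_add has_integral_diff has_integral_mult_right) simp_all
  moreover have "((\<lambda>y. ?A1 * (P (of_real y / \<tau> + 2) * g (of_real y / \<tau>)) -
      ?A2 * (P (of_real y / \<tau>) * g (of_real y / \<tau>))
        + ?A3 * (P (of_real y / \<tau> - 2) * g (of_real y / \<tau>))) has_integral 0) {0..1}"
  proof -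
    have "((\<lambda>y. h (2 + of_real y / \<tau>) - h (0 + of_real y / \<tau>)) has_integral 0) {0..1}"
      using has_integral_diff[OF h_integral[of 2] h_integral[of 0]] by simp
    then show ?thesis
      by (simp only: step[OF Re_of_real_div_tau(2)] add_0_left add.commute[of 2])
  qed
  ultimately show ?thesis
    by (rule has_integral_unique)
qed

section \<open>The Askey-Wilson equation\<close>

lemma Delta_AW_eq: "Delta_AW \<tau> a b c d x =
  (rG ((- of_real c - x) + 1 / (2 * \<tau>) + 1) * rG ((- of_real d - x) + 1 / (2 * \<tau>) + 1)) /
  (rG ((of_real a - x) + 1 / (2 * \<tau>) - 1) * rG ((of_real b - x) + 1 / (2 * \<tau>) - 1))"
proof -
  have args: "- 1 + 1 / (2 * \<tau>) + of_real e - x = (of_real e - x) + 1 / (2 * \<tau>) - 1"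
    "1 + 1 / (2 * \<tau>) - of_real e - x = (- of_real e - x) + 1 / (2 * \<tau>) + 1" for e
    by simp_all
  show ?thesis
    unfolding Delta_AW_def Gamma2tau_eq args
    by (simp only: divide_inverse inverse_mult_distrib inverse_inverse_eq mult_ac)
qed

text \<open>Each \<open>rG\<close> factor contributes - \<i> and one \<open>S\<close>; the constants
  cancel between numerator and denominator.\<close>

lemma Delta_AW_rec: "Delta_AW \<tau> a b c d (x + 2) = Delta_AW \<tau> a b c d x *
  ((S (- of_real c - x) * S (- of_real d - x)) / (S (of_real a - x - 2) * S (of_real b - x - 2)))"
proof -
  let ?h = "1 / (2 * \<tau>)"
  have num: "rG ((- of_real e - (x + 2)) + ?h + 1) =
      - \<i> * S (- of_real e - x) * rG ((- of_real e - x) + ?h + 1)" for e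
  proof -
    have "(- of_real e - (x + 2)) + ?h + 1 = (- of_real e - x) + ?h - 1"
      by simp
    then show ?thesis
      by (simp only: rG_rec_plus)
  qed
  have den: "rG ((of_real e - (x + 2)) + ?h - 1) =
      - \<i> * S (of_real e - x - 2) * rG ((of_real e - x) + ?h - 1)" for e
  proof -
    have "(of_real e - (x + 2)) + ?h - 1 = (of_real e - x - 2) + ?h - 1"
      "(of_real e - x - 2) + ?h + 1 = (of_real e - x) + ?h - 1"
      by simp_all
    then show ?thesis
      by (simp only: rG_rec_plus)
  qed
  have cancel: "((j * s1 * n1) * (j * s2 * n2)) / ((j * s3 * d1) * (j * s4 * d2)) =
      (n1 * n2) / (d1 * d2) * ((s1 * s2) / (s3 * s4))"
    if "j \<noteq> 0" for j s1 s2 s3 s4 n1 n2 d1 d2 :: complex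
  proof -
    have "((j * s1 * n1) * (j * s2 * n2)) / ((j * s3 * d1) * (j * s4 * d2)) =
        ((j * j) * ((n1 * n2) * (s1 * s2))) / ((j * j) * ((d1 * d2) * (s3 * s4)))"
      by (simp only: mult_ac)
    also have "\<dots> = ((n1 * n2) * (s1 * s2)) / ((d1 * d2) * (s3 * s4))"
      using that by (intro nonzero_mult_divide_mult_cancel_left) simp
    finally show ?thesis
      by (simp only: times_divide_times_eq)
  qed
  show ?thesis
    unfolding Delta_AW_eq num den by (rule cancel) simp
qed

lemma meromorphic_on_Delta_AW: "Delta_AW \<tau> a b c d meromorphic_on A"
proof -
  have rG: "(\<lambda>x. rG (e - x + g)) meromorphic_on A" for e g
    using holomorphic_on_rG[of "\<lambda>x. e - x + g" UNIV]
    by (intro analytic_on_imp_meromorphic_on)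
      (auto intro!: holomorphic_intros simp: analytic_on_open intro: analytic_on_subset[of _ UNIV])
  have "(\<lambda>x. Delta_AW \<tau> a b c d x) meromorphic_on A"
    unfolding Delta_AW_eq add.assoc add_diff_eq[symmetric]
    by (intro meromorphic_intros rG)
  then show ?thesis .
qed

text \<open>The multipliers depend on the parameters only through a + b + c + d and combine to
  q^(-\<beta>/(2\<tau>)).\<close>

lemma Delta_AW_periodic:
  assumes "a + b + c + d = 4 - 2 * \<beta>" and "Q (of_real \<beta> / (2 * \<tau>)) = 1"
  shows "Delta_AW \<tau> a b c d (x + 1 / \<tau>) = Delta_AW \<tau> a b c d x"
proof -
  let ?e = "1 / (8 * \<tau>\<^sup>2)"
  define w1 w2 w3 w4 where
    "w1 = (- of_real c - x) + 1 / (2 * \<tau>) + 1" and "w2 = (- of_real d - x) + 1 / (2 * \<tau>) + 1" and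
    "w3 = (of_real a - x) + 1 / (2 * \<tau>) - 1" and "w4 = (of_real b - x) + 1 / (2 * \<tau>) - 1"
  have "(- of_real c - (x + 1 / \<tau>)) + 1 / (2 * \<tau>) + 1 = w1 - 1 / \<tau>"
    "(- of_real d - (x + 1 / \<tau>)) + 1 / (2 * \<tau>) + 1 = w2 - 1 / \<tau>"
    "(of_real a - (x + 1 / \<tau>)) + 1 / (2 * \<tau>) - 1 = w3 - 1 / \<tau>"
    "(of_real b - (x + 1 / \<tau>)) + 1 / (2 * \<tau>) - 1 = w4 - 1 / \<tau>"
    by (simp_all add: w1_def w2_def w3_def w4_def)
  then have *: "Delta_AW \<tau> a b c d (x + 1 / \<tau>) = (rG w1 * rG w2) / (rG w3 * rG w4) *
      ((Q (- w1 / (4 * \<tau>) + ?e) * Q (- w2 / (4 * \<tau>) + ?e)) /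
       (Q (- w3 / (4 * \<tau>) + ?e) * Q (- w4 / (4 * \<tau>) + ?e)))"
    by (simp only: Delta_AW_eq rG_diff_period times_divide_times_eq mult_ac)
  have "(Q (- w1 / (4 * \<tau>) + ?e) * Q (- w2 / (4 * \<tau>) + ?e)) /
       (Q (- w3 / (4 * \<tau>) + ?e) * Q (- w4 / (4 * \<tau>) + ?e)) = Q (- (of_real \<beta> / (2 * \<tau>)))"
  proof -
    have "(- w1 / (4 * \<tau>) + ?e + (- w2 / (4 * \<tau>) + ?e)) - (- w3 / (4 * \<tau>) + ?e + (- w4 / (4 * \<tau>) + ?e)) =
        (w3 + w4 - w1 - w2) / (4 * \<tau>)"
      by (simp add: add_divide_distrib diff_divide_distrib)
    also have "w3 + w4 - w1 - w2 = of_real (a + b + c + d) - 4"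
      by (simp add: w1_def w2_def w3_def w4_def)
    also have "\<dots> = - 2 * of_real \<beta>"
      by (simp add: assms(1))
    also have "- 2 * of_real \<beta> / (4 * \<tau>) = - (of_real \<beta> / (2 * \<tau>))"
      by simp
    finally show ?thesis
      unfolding Q_add[symmetric] Q_diff[symmetric] by (rule arg_cong)
  qed
  also have "\<dots> = 1"
    using assms(2) by (simp add: Q_minus)
  finally show ?thesis
    unfolding * by (simp add: Delta_AW_eq w1_def w2_def w3_def w4_def)
qed

text \<open>a and b differ only in the sign of \<rho>, c and d only in that of \<alpha> + \<rho>, so
  the numerator factors combine in pairs. After cancelling monomials, q s / W = q^(1 - \<beta>)
  remains.\<close>

lemma A_AW_eq:
  assumes abcd: "a = 1 + \<rho> + \<sigma>" "b = 1 - \<rho> + \<sigma>" "c = 1 + \<alpha> + \<rho> - \<beta> - \<sigma>" "d = 1 - \<alpha> - \<rho> - \<beta> - \<sigma>"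
    and defs: "q = Q 1" "s = Q (of_real \<sigma>)" "W = Q (of_real \<beta> + of_real \<sigma>)" "X = Q x"
      "v = C (of_real \<rho>)" "U = C (of_real \<alpha> + of_real \<rho>)"
  shows "A_AW \<tau> a b c d x =
    q * s / W * ((v - csum (q * s * X)) * (U - csum (q * X / W))) / ((X - 1 / X) * (q * X - 1 / (q * X)))"
proof -
  define r t where "r = Q (of_real \<rho>)" and "t = Q (of_real \<alpha> + of_real \<rho>)"
  have nz: "q \<noteq> 0" "s \<noteq> 0" "W \<noteq> 0" "X \<noteq> 0" "r \<noteq> 0" "t \<noteq> 0"
    by (simp_all add: defs r_def t_def)
  have Qs: "Q (of_real a + x) = q * r * s * X" "Q (of_real b + x) = q * s * X / r"
    "Q (of_real c + x) = q * t * X / W" "Q (of_real d + x) = q * X / (t * W)"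
    "Q (2 * x) = X\<^sup>2" "Q (2 + 2 * x) = q\<^sup>2 * X\<^sup>2"
    unfolding abcd defs r_def t_def power2_eq_square Q_add[symmetric] Q_diff[symmetric]
    by (simp_all add: algebra_simps)
  have vU: "v = csum r" "U = csum t"
    by (simp_all add: defs r_def t_def C_eq_csum)
  have "(1 - q * r * s * X) * (1 - q * s * X / r) = - (q * s * X) * (v - csum (q * s * X))"
    using nz unfolding vU csum_def by (simp add: divide_simps) algebra
  moreover have "(1 - q * t * X / W) * (1 - q * X / (t * W)) = - (q * X / W) * (U - csum (q * X / W))"
    using nz unfolding vU csum_def by (simp add: divide_simps) algebra
  moreover have "(1 - X\<^sup>2) * (1 - q\<^sup>2 * X\<^sup>2) = (q * X\<^sup>2) * ((X - 1 / X) * (q * X - 1 / (q * X)))"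
    using nz by (simp add: divide_simps) algebra
  ultimately have "A_AW \<tau> a b c d x =
      ((- (q * s * X) * (v - csum (q * s * X))) * (- (q * X / W) * (U - csum (q * X / W)))) /
      ((q * X\<^sup>2) * ((X - 1 / X) * (q * X - 1 / (q * X))))"
    unfolding A_AW_def Qs by (simp only: mult.assoc)
  also have "\<dots> = ((q * X\<^sup>2) * (q * s / W * ((v - csum (q * s * X)) * (U - csum (q * X / W))))) /
      ((q * X\<^sup>2) * ((X - 1 / X) * (q * X - 1 / (q * X))))"
    by (simp add: power2_eq_square mult_ac)
  also have "\<dots> = q * s / W * ((v - csum (q * s * X)) * (U - csum (q * X / W))) /
      ((X - 1 / X) * (q * X - 1 / (q * X)))"
    using nz by (intro nonzero_mult_divide_mult_cancel_left) simp
  finally show ?thesis .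
qed

lemma E_AW_eq:
  assumes "g = Q (1 - of_real \<beta>)" "J = Q (2 * \<i> * of_real lam)"
  shows "E_AW \<tau> \<beta> lam = g * (csum J - csum g)"
proof -
  have "Q (2 - 2 * of_real \<beta>) = g\<^sup>2"
    unfolding assms power2_eq_square Q_add[symmetric] by simp
  moreover have "g \<noteq> 0" "J \<noteq> 0"
    by (simp_all add: assms)
  ultimately show ?thesis
    unfolding E_AW_def assms(1)[symmetric] Q_minus assms(2)[symmetric] csum_def
    by (simp add: algebra_simps power2_eq_square divide_inverse)
qed

text \<open>The \<open>S\<close> arguments in \<open>Delta_AW_rec\<close> lie symmetrically about
  \<beta> + \<sigma> - 1 - x and \<sigma> - 1 - x, at distance \<alpha> + \<rho> and \<rho>, so
  \<open>S_mult_S\<close> applies.\<close>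

lemma Delta_AW_contiguous:
  assumes abcd: "a = 1 + \<rho> + \<sigma>" "b = 1 - \<rho> + \<sigma>" "c = 1 + \<alpha> + \<rho> - \<beta> - \<sigma>" "d = 1 - \<alpha> - \<rho> - \<beta> - \<sigma>"
    and defs: "q = Q 1" "s = Q (of_real \<sigma>)" "W = Q (of_real \<beta> + of_real \<sigma>)" "X = Q x"
      "v = C (of_real \<rho>)" "U = C (of_real \<alpha> + of_real \<rho>)"
  shows "Delta_AW \<tau> a b c d (x + 2) =
    Delta_AW \<tau> a b c d x * ((csum (q * X / W) - U) / (csum (s / (q * X)) - v))"
proof -
  have "S (- of_real c - x) * S (- of_real d - x) = C (- (1 - of_real \<beta> - of_real \<sigma> + x)) - U"
    unfolding S_mult_S[symmetric] abcd defs by (simp add: algebra_simps)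
  also have "C (- (1 - of_real \<beta> - of_real \<sigma> + x)) = csum (q * X / W)"
    by (subst C_minus) (simp add: C_eq_csum defs Q_add Q_diff)
  finally have 1: "S (- of_real c - x) * S (- of_real d - x) = csum (q * X / W) - U" .
  have "S (of_real a - x - 2) * S (of_real b - x - 2) = C (of_real \<sigma> - (1 + x)) - v"
    unfolding S_mult_S[symmetric] abcd defs by (simp add: algebra_simps)
  also have "C (of_real \<sigma> - (1 + x)) = csum (s / (q * X))"
    unfolding C_eq_csum defs Q_add[symmetric] Q_diff[symmetric] by (simp add: algebra_simps)
  finally have 2: "S (of_real a - x - 2) * S (of_real b - x - 2) = csum (s / (q * X)) - v" .
  show ?thesis
    unfolding Delta_AW_rec 1 2 ..
qed

text \<open>Each outer coefficient of \<open>phi_AW_contiguous\<close> is a product of two factors: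
  one occurs in A(x) or A(-x), the other in the quotient of \<open>Delta_AW\<close> at x and x + 2
  or x - 2.\<close>

lemma Askey_Wilson_equation:
  fixes \<alpha> \<beta> \<rho> \<sigma> lam :: real
  assumes abcd: "a = 1 + \<rho> + \<sigma>" "b = 1 - \<rho> + \<sigma>" "c = 1 + \<alpha> + \<rho> - \<beta> - \<sigma>" "d = 1 - \<alpha> - \<rho> - \<beta> - \<sigma>"
    and pos: "\<alpha> \<ge> 1" "\<beta> \<ge> 1" "\<rho> \<ge> 3" "\<sigma> \<ge> 3"
    and per: "Q (of_real \<alpha> / (2 * \<tau>)) = 1" "Q (of_real \<beta> / (2 * \<tau>)) = 1"
    and generic: "\<rho> \<noteq> \<sigma> + 1" "\<alpha> + \<rho> \<noteq> \<beta> + \<sigma> - 1" "\<alpha> + \<rho> \<noteq> \<beta> + \<sigma> + 1"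
    and x: "Re x = 0" "Q (2 * x) \<noteq> 1"
    and F: "F = (\<lambda>x. inverse (Delta_AW \<tau> a b c d x) * phi_AW \<tau> \<alpha> \<beta> \<rho> \<sigma> lam x)"
  shows "A_AW \<tau> a b c d x * (F (x + 2) - F x) + A_AW \<tau> a b c d (- x) * (F (x - 2) - F x) =
    E_AW \<tau> \<beta> lam * F x"
proof -
  define q s W X J v U where defs: "q = Q 1" "s = Q (of_real \<sigma>)" "W = Q (of_real \<beta> + of_real \<sigma>)" "X = Q x"
    "J = Q (2 * \<i> * of_real lam)" "v = C (of_real \<rho>)" "U = C (of_real \<alpha> + of_real \<rho>)"
  define \<omega> \<theta> \<eta> where ots: "\<omega> = X / q - q / X" "\<theta> = q * X - 1 / (q * X)" "\<eta> = X - 1 / X"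
  define k where "k = q * s / W"
  define \<delta> where "\<delta> = inverse (Delta_AW \<tau> a b c d x)"
  define \<phi> \<phi>1 \<phi>2 where "\<phi> = phi_AW \<tau> \<alpha> \<beta> \<rho> \<sigma> lam x"
    and "\<phi>1 = phi_AW \<tau> \<alpha> \<beta> \<rho> \<sigma> lam (x + 2)" and "\<phi>2 = phi_AW \<tau> \<alpha> \<beta> \<rho> \<sigma> lam (x - 2)"
  have nz: "q \<noteq> 0" "s \<noteq> 0" "W \<noteq> 0" "X \<noteq> 0" "J \<noteq> 0"
    by (simp_all add: defs)
  have sW: "C (of_real \<sigma>) = csum s" "C (of_real \<beta> + of_real \<sigma>) = csum W"
    by (simp_all add: C_eq_csum defs)
  have k: "k = Q (1 - of_real \<beta>)"
    unfolding k_def defs Q_add[symmetric] Q_diff[symmetric] by (simp add: algebra_simps)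

  define y1 y2 y3 y4 y5 y6 where ys: "y1 = csum (q * s * X)" "y2 = csum (q * X / W)"
      "y3 = csum (s / (q * X))"
    "y4 = csum (q * s / X)" "y5 = csum (q / (X * W))" "y6 = csum (X / (q * W))"
  have A1: "A_AW \<tau> a b c d x = k * ((v - y1) * (U - y2)) / (\<eta> * \<theta>)"
    unfolding k_def ys ots by (rule A_AW_eq[OF abcd defs(1-4,6,7)])
  have A2: "A_AW \<tau> a b c d (- x) = k * ((v - y4) * (U - y5)) / (\<eta> * \<omega>)"
  proof -
    have "A_AW \<tau> a b c d (- x) =
        k * ((v - csum (q * s * (1 / X))) * (U - csum (q * (1 / X) / W))) /
        ((1 / X - 1 / (1 / X)) * (q * (1 / X) - 1 / (q * (1 / X))))"
      unfolding k_def by (rule A_AW_eq[OF abcd defs(1-3) _ defs(6,7)]) (simp add: defs Q_minus divide_inverse)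
    also have "(1 / X - 1 / (1 / X)) * (q * (1 / X) - 1 / (q * (1 / X))) = \<eta> * \<omega>"
      unfolding ots by (simp add: algebra_simps)
    finally show ?thesis
      by (simp add: ys)
  qed

  have D1: "Delta_AW \<tau> a b c d (x + 2) = Delta_AW \<tau> a b c d x * ((y2 - U) / (y3 - v))"
    unfolding ys by (rule Delta_AW_contiguous[OF abcd defs(1-4,6,7)])
  have D2: "Delta_AW \<tau> a b c d x = Delta_AW \<tau> a b c d (x - 2) * ((y6 - U) / (y4 - v))"
  proof -
    have Q2: "Q (x - 2) = X / q\<^sup>2"
      by (simp add: defs Q_diff Q_2_eq)
    have "Delta_AW \<tau> a b c d (x - 2 + 2) =
        Delta_AW \<tau> a b c d (x - 2) * ((csum (q * (X / q\<^sup>2) / W) - U) / (csum (s / (q * (X / q\<^sup>2))) - v))"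
      by (rule Delta_AW_contiguous[OF abcd defs(1-3) Q2[symmetric] defs(6,7)])
    moreover have "q * (X / q\<^sup>2) / W = X / (q * W)" "s / (q * (X / q\<^sup>2)) = q * s / X"
      using nz by (simp_all add: power2_eq_square)
    ultimately show ?thesis
      by (simp add: ys)
  qed
  \<comment> \<open>For the three differences, \<open>C_diff_nonzero\<close> compares \<alpha> +
    \<rho> with \<beta> + \<sigma> - 1 and \<beta> + \<sigma> + 1, and \<rho> with \<sigma> +
    1.\<close>
  have "U - y2 \<noteq> 0"
  proof -
    have "C (of_real \<alpha> + of_real \<rho>) - C (1 + x - (of_real \<beta> + of_real \<sigma>)) \<noteq> 0"
      using x pos generic by (intro C_diff_nonzero) auto
    moreover have "C (1 + x - (of_real \<beta> + of_real \<sigma>)) = y2"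
      unfolding ys C_eq_csum Q_diff Q_add defs ..
    ultimately show ?thesis
      by (simp add: defs)
  qed
  moreover have "U - y6 \<noteq> 0"
  proof -
    have "C (of_real \<alpha> + of_real \<rho>) - C (x - (1 + (of_real \<beta> + of_real \<sigma>))) \<noteq> 0"
      using x pos generic by (intro C_diff_nonzero) auto
    moreover have "C (x - (1 + (of_real \<beta> + of_real \<sigma>))) = y6"
      unfolding ys C_eq_csum Q_diff Q_add defs ..
    ultimately show ?thesis
      by (simp add: defs)
  qed
  moreover have "v - y4 \<noteq> 0"
  proof -
    have "C (of_real \<rho>) - C (1 + of_real \<sigma> - x) \<noteq> 0"
      using x pos generic by (intro C_diff_nonzero) auto
    moreover have "C (1 + of_real \<sigma> - x) = y4"
      unfolding ys C_eq_csum Q_diff Q_add defs ..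
    ultimately show ?thesis
      by (simp add: defs)
  qed
  \<comment> \<open>This is where genericity of x enters: \<eta> = 0 means q^(2x) = 1. For \<theta>
    and \<omega> it is enough that x is imaginary.\<close>
  moreover have "\<eta> \<noteq> 0"
  proof
    assume "\<eta> = 0"
    then have "X * X = 1"
      using nz(4) by (simp add: ots(3) eq_divide_eq)
    then have "Q (x + x) = 1"
      unfolding Q_add defs(4) .
    then show False
      using x(2) unfolding mult_2 by contradiction
  qed
  moreover have "\<theta> \<noteq> 0" "\<omega> \<noteq> 0"
  proof -
    have "Q ((1 + x) + (1 + x)) \<noteq> 1" "Q ((x - 1) + (x - 1)) \<noteq> 1"
      using Q_eq_1_imp[of "(1 + x) + (1 + x)"] Q_eq_1_imp[of "(x - 1) + (x - 1)"] x(1) by auto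
    then have "(q * X) * (q * X) \<noteq> 1" "(X / q) * (X / q) \<noteq> 1"
      unfolding Q_add Q_diff defs .
    moreover have "\<theta> = q * X - 1 / (q * X)" "\<omega> = X / q - 1 / (X / q)"
      by (simp_all add: ots)
    moreover have "y - 1 / y \<noteq> 0" if "y * y \<noteq> 1" "y \<noteq> 0" for y :: complex
      using that by (simp add: eq_divide_eq)
    ultimately show "\<theta> \<noteq> 0" "\<omega> \<noteq> 0"
      using nz(1,4) by (metis mult_eq_0_iff, metis divide_eq_0_iff)
  qed
  ultimately have nonzero: "U - y2 \<noteq> 0" "U - y6 \<noteq> 0" "v - y4 \<noteq> 0" "\<eta> \<noteq> 0" "\<theta> \<noteq> 0" "\<omega> \<noteq> 0"
    by blast+

  \<comment> \<open>Extracting this factor clears the denominators \<eta> \<theta> of A(x) and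
    \<eta> \<omega> of A(-x).\<close>
  define \<kappa> where "\<kappa> = k / (\<eta> * \<theta> * \<omega>)"
  have A1': "A_AW \<tau> a b c d x = \<kappa> * (\<omega> * ((v - y1) * (U - y2)))"
    using nonzero by (simp add: A1 \<kappa>_def)
  have A2': "A_AW \<tau> a b c d (- x) = \<kappa> * (\<theta> * ((v - y4) * (U - y5)))"
    using nonzero by (simp add: A2 \<kappa>_def)
  have E': "E_AW \<tau> \<beta> lam = \<kappa> * (\<eta> * \<theta> * \<omega> * (csum J - csum k))"
    using nonzero by (simp add: E_AW_eq[OF k defs(5)] \<kappa>_def)

  have F0: "F x = \<delta> * \<phi>"
    by (simp add: F \<delta>_def \<phi>_def)
  \<comment> \<open>If v = y3, the quotient in \<open>D1\<close> is 0 by convention, and so are both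
    sides here.\<close>
  have F1: "(U - y2) * F (x + 2) = (v - y3) * \<delta> * \<phi>1"
  proof -
    have "(y2 - U) / (y3 - v) = (U - y2) / (v - y3)"
      using minus_divide_divide[of "U - y2" "v - y3"] by simp
    then have "F (x + 2) = (v - y3) / (U - y2) * (\<delta> * \<phi>1)"
      by (simp add: F D1 \<delta>_def \<phi>1_def divide_inverse mult_ac)
    then show ?thesis
      using nonzero by simp
  qed
  have F2: "(v - y4) * F (x - 2) = (U - y6) * \<delta> * \<phi>2"
  proof -
    have "(y6 - U) / (y4 - v) = (U - y6) / (v - y4)"
      using minus_divide_divide[of "U - y6" "v - y4"] by simp
    then have "\<delta> = inverse (Delta_AW \<tau> a b c d (x - 2)) * ((v - y4) / (U - y6))"
      by (simp add: D2 \<delta>_def divide_inverse mult_ac)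
    then show ?thesis
      using nonzero by (simp add: F \<phi>2_def divide_inverse mult_ac)
  qed

  \<comment> \<open>y1 and y5 belong to A(x) and A(-x), y3 and y6 to the quotients of
    \<open>Delta_AW\<close>.\<close>
  have resultants: "(csum s)\<^sup>2 + v\<^sup>2 - 4 - csum s * v * csum (q * X) + (csum (q * X))\<^sup>2 =
      (v - y1) * (v - y3)"
    "U\<^sup>2 + (csum W)\<^sup>2 - 4 - U * csum W * csum (X / q) + (csum (X / q))\<^sup>2 = (U - y5) * (U - y6)"
  proof -
    have "(v - csum (s * (q * X))) * (v - csum (s / (q * X))) =
        (csum s)\<^sup>2 + v\<^sup>2 - 4 - csum s * v * csum (q * X) + (csum (q * X))\<^sup>2"
      using nz by (intro csum_resultant) auto
    moreover have "(U - csum (W * (X / q))) * (U - csum (W / (X / q))) =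
        (csum W)\<^sup>2 + U\<^sup>2 - 4 - csum W * U * csum (X / q) + (csum (X / q))\<^sup>2"
      using nz by (intro csum_resultant) auto
    moreover have "csum (W * (X / q)) = y5" "csum (W / (X / q)) = y6"
      using nz by (simp_all add: ys csum_def mult.commute add.commute)
    ultimately show "(csum s)\<^sup>2 + v\<^sup>2 - 4 - csum s * v * csum (q * X) + (csum (q * X))\<^sup>2 =
        (v - y1) * (v - y3)"
      "U\<^sup>2 + (csum W)\<^sup>2 - 4 - U * csum W * csum (X / q) + (csum (X / q))\<^sup>2 = (U - y5) * (U - y6)"
      by (simp_all add: ys mult_ac add_ac)
  qed
  have middle: "\<omega> * ((v - y1) * (U - y2)) + \<theta> * ((v - y4) * (U - y5)) + \<eta> * \<theta> * \<omega> * (csum J - csum k) =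
      \<eta> * ((q + 1 / q) * (v * U + csum s * csum W) - csum X * (v * csum W + csum s * U) + \<theta> * \<omega> * csum J)"
    unfolding ys k_def ots(3) using nz by (intro middle_coefficient ots)
  have contiguous: "((v - y1) * (v - y3)) * \<omega> * \<phi>1
      - \<eta> * ((q + 1 / q) * (v * U + csum s * csum W) - csum X * (v * csum W + csum s * U) +
          \<theta> * \<omega> * csum J) * \<phi>
      + ((U - y5) * (U - y6)) * \<theta> * \<phi>2 = 0"
    using phi_AW_contiguous[OF x(1) pos per defs(1,4,5) ots(1,2) refl defs(6,7) refl]
    unfolding sW resultants ots(3) \<phi>_def \<phi>1_def \<phi>2_def .

  have "A_AW \<tau> a b c d x * (F (x + 2) - F x) + A_AW \<tau> a b c d (- x) * (F (x - 2) - F x) -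
      E_AW \<tau> \<beta> lam * F x =
      \<kappa> * (\<omega> * (v - y1) * ((U - y2) * F (x + 2)) + \<theta> * (U - y5) * ((v - y4) * F (x - 2))
        - (\<omega> * ((v - y1) * (U - y2)) + \<theta> * ((v - y4) * (U - y5)) + \<eta> * \<theta> * \<omega> * (csum J - csum k)) * F x)"
    unfolding A1' A2' E' by algebra
  also have "\<dots> = \<kappa> * \<delta> * (((v - y1) * (v - y3)) * \<omega> * \<phi>1
      - \<eta> * ((q + 1 / q) * (v * U + csum s * csum W) - csum X * (v * csum W + csum s * U) +
          \<theta> * \<omega> * csum J) * \<phi>
      + ((U - y5) * (U - y6)) * \<theta> * \<phi>2)"
    unfolding middle F0 F1 F2 by (simp only: algebra_simps)
  also have "\<dots> = 0"
    unfolding contiguous by simp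
  finally show ?thesis
    by simp
qed

end

theorem corollary4p5:
  fixes \<tau> :: complex and lam \<rho> \<sigma> a b c d :: real and \<alpha> \<beta> :: nat
    and \<Delta> F :: "complex \<Rightarrow> complex"
  assumes "Re \<tau> = 0" and "Im \<tau> > 0"
    and "even \<alpha>" and "\<alpha> > 0" and "even \<beta>" and "\<beta> > 0"
    and "\<rho> \<ge> 3" and "\<sigma> \<ge> 3"
    and "(a, b, c, d) =
      (1 + \<rho> + \<sigma>, 1 - \<rho> + \<sigma>, 1 + real \<alpha> + \<rho> - real \<beta> - \<sigma>, 1 - real \<alpha> - \<rho> - real \<beta> - \<sigma>)"
    and "\<Delta> = Delta_AW \<tau> a b c d"
    and "F = (\<lambda>x. inverse (\<Delta> x) * phi_AW \<tau> (real \<alpha>) (real \<beta>) \<rho> \<sigma> lam x)"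
  shows "\<Delta> meromorphic_on UNIV \<and> (\<forall>x. \<Delta> (x + 1 / \<tau>) = \<Delta> x) \<and>
    (generic_params \<rho> \<sigma> \<longrightarrow>
      (\<forall>x. Re x = 0 \<and> generic_point \<tau> x \<longrightarrow>
        A_AW \<tau> a b c d x * (F (x + 2) - F x) + A_AW \<tau> a b c d (- x) * (F (x - 2) - F x)
          = E_AW \<tau> (real \<beta>) lam * F x))"
proof -
  interpret imaginary_modulus \<tau>
    using assms(1,2) by unfold_locales
  have abcd: "a = 1 + \<rho> + \<sigma>" "b = 1 - \<rho> + \<sigma>" "c = 1 + real \<alpha> + \<rho> - real \<beta> - \<sigma>"
    "d = 1 - real \<alpha> - \<rho> - real \<beta> - \<sigma>"
    using assms(9) by simp_all
  note per = Q_even[OF assms(3)] Q_even[OF assms(5)]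
  have "\<Delta> (x + 1 / \<tau>) = \<Delta> x" for x
    unfolding assms(10) by (rule Delta_AW_periodic[OF _ per(2)]) (simp add: abcd)
  moreover have "A_AW \<tau> a b c d x * (F (x + 2) - F x) + A_AW \<tau> a b c d (- x) * (F (x - 2) - F x)
      = E_AW \<tau> (real \<beta>) lam * F x"
    if "generic_params \<rho> \<sigma>" and x: "Re x = 0" "generic_point \<tau> x" for x
  proof (rule Askey_Wilson_equation[OF abcd _ _ assms(7,8) per])
    \<comment> \<open>With \<alpha> = 2 i and \<beta> = 2 j, the three excluded equalities would
      make \<rho> - \<sigma> one of the odd integers 1, 2 (j - i) - 1 and 2 (j - i) + 1.\<close>
    obtain i j where ij: "\<alpha> = 2 * i" "\<beta> = 2 * j"
      using assms(3,5) by (auto elim!: evenE)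
    have odd: "\<rho> - \<sigma> \<noteq> 2 * real_of_int n + 1" for n
      using that(1) by (auto simp: generic_params_def)
    show "\<rho> \<noteq> \<sigma> + 1"
      using odd[of 0] by auto
    show "real \<alpha> + \<rho> \<noteq> real \<beta> + \<sigma> - 1"
      using odd[of "int j - int i - 1"] by (auto simp: ij)
    show "real \<alpha> + \<rho> \<noteq> real \<beta> + \<sigma> + 1"
      using odd[of "int j - int i"] by (auto simp: ij)
    show "F = (\<lambda>x. inverse (Delta_AW \<tau> a b c d x) * phi_AW \<tau> (real \<alpha>) (real \<beta>) \<rho> \<sigma> lam x)"
      using assms(10,11) by simp
  qed (use assms(4,6) x in \<open>auto simp: generic_point_def\<close>)
  ultimately show ?thesis
    using meromorphic_on_Delta_AW assms(10) by auto
qed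

end
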